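(* Let $\nu\ge 2$ be an integer and let $\tau>0$. Let $\Sigma=\Sigma(\nu,\tau)\subset\{0,1,\dots,2\nu\}^{\mathbb Z}$ be the two-coloured subshift defined in the context, with shift $\sigma$. If $\tau\ge\frac{\log 3}{\log\nu}$, then there are two mutually singular measures of maximal entropy on $\Sigma$.
   Context: Alphabet: $\mathcal{A}=\{0,1,\dots,2\nu\}=\{0\}\cup\mathcal{G}\cup\mathcal{Y}$, where $\mathcal{G}=\{1,\dots,\nu\}$ are the green symbols and $\mathcal{Y}=\{\nu+1,\dots,2\nu\}$ the yellow symbols; the symbols in $\mathcal{G}\cup\mathcal{Y}$ are called coloured. $\Sigma_{\mathcal G}=\mathcal{G}^{\mathbb Z}$ and $\Sigma_{\mathcal Y}=\mathcal{Y}^{\mathbb Z}$ are the green and yellow full $\nu$-shifts. Definition of $\Sigma$: a sequence $x\in\mathcal{A}^{\mathbb Z}$ belongs to $\Sigma$ if and only if either $x\in\Sigma_{\mathcal G}\cup\Sigma_{\mathcal Y}$ (then $x$ is called monochromatic), or the following holds. Every maximal block of consecutive coloured symbols in $x$ consists of symbols of a single colour. Any two successive such blocks (i.e. separated only by zeros) have different colours, are both of finite lengths $a$ and $b$, and are separated by a string of zeros $0^\lambda$ whose length satisfies $\lambda\ge\tau(a+b)$. In particular, an infinitely long coloured block can only be adjacent to an infinite string of zeros. Sequences with at most one coloured block, and zeros elsewhere, are allowed. The shift is $(\sigma x)_i=x_{i+1}$, and $\Sigma$ carries the topology generated by cylinder sets (the topology induced from the product topology on $\mathcal{A}^{\mathbb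 Z}$). A measure of maximal entropy is a $\sigma$-invariant Borel probability measure on $\Sigma$ whose metric (Kolmogorov–Sinai) entropy equals the topological entropy of $\sigma:\Sigma\to\Sigma$. *)

theory Defs
  imports "HOL-Probability.Probability"
begin

section \<open>The two-coloured subshift\<close>

definition green :: "nat \<Rightarrow> nat set" where
  "green \<nu> = {1..\<nu>}"

definition yellow :: "nat \<Rightarrow> nat set" where
  "yellow \<nu> = {\<nu>+1..2*\<nu>}"

definition alphabet :: "nat \<Rightarrow> nat set" where
  "alphabet \<nu> = {0} \<union> green \<nu> \<union> yellow \<nu>"

definition full_shift :: "nat set \<Rightarrow> (int \<Rightarrow> nat) set" where
  "full_shift A = {x. \<forall>i. x i \<in> A}"

definition left_shift :: "(int \<Rightarrow> nat) \<Rightarrow> (int \<Rightarrow> nat)" where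
  "left_shift x = (\<lambda>i. x (i + 1))"

text \<open>A coloured run is a nonempty, possibly infinite, set of consecutive positions carrying
  coloured symbols; a coloured block is a maximal one.\<close>

definition coloured_run :: "nat \<Rightarrow> (int \<Rightarrow> nat) \<Rightarrow> int set \<Rightarrow> bool" where
  "coloured_run \<nu> x B \<longleftrightarrow>
     B \<noteq> {} \<and> (\<forall>i\<in>B. \<forall>j\<in>B. {i..j} \<subseteq> B) \<and> (\<forall>i\<in>B. x i \<in> green \<nu> \<union> yellow \<nu>)"

definition coloured_block :: "nat \<Rightarrow> (int \<Rightarrow> nat) \<Rightarrow> int set \<Rightarrow> bool" where
  "coloured_block \<nu> x B \<longleftrightarrow>
     coloured_run \<nu> x B \<and> (\<forall>C. coloured_run \<nu> x C \<and> B \<subseteq> C \<longrightarrow> C = B)"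

definition gap :: "int set \<Rightarrow> int set \<Rightarrow> int set" where
  "gap B C = {k. (\<forall>i\<in>B. i < k) \<and> (\<forall>j\<in>C. k < j)}"

definition successive_blocks :: "nat \<Rightarrow> (int \<Rightarrow> nat) \<Rightarrow> int set \<Rightarrow> int set \<Rightarrow> bool" where
  "successive_blocks \<nu> x B C \<longleftrightarrow>
     coloured_block \<nu> x B \<and> coloured_block \<nu> x C \<and>
     (\<forall>i\<in>B. \<forall>j\<in>C. i < j) \<and> (\<forall>k\<in>gap B C. x k = 0)"

definition two_coloured_shift :: "nat \<Rightarrow> real \<Rightarrow> (int \<Rightarrow> nat) set" where
  "two_coloured_shift \<nu> \<tau> = {x \<in> full_shift (alphabet \<nu>).
     x \<in> full_shift (green \<nu>) \<union> full_shift (yellow \<nu>) \<or>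
     ((\<forall>B. coloured_block \<nu> x B \<longrightarrow> x ` B \<subseteq> green \<nu> \<or> x ` B \<subseteq> yellow \<nu>) \<and>
      (\<forall>B C. successive_blocks \<nu> x B C \<longrightarrow>
         (x ` B \<subseteq> green \<nu> \<and> x ` C \<subseteq> yellow \<nu> \<or> x ` B \<subseteq> yellow \<nu> \<and> x ` C \<subseteq> green \<nu>) \<and>
         finite B \<and> finite C \<and>
         real (card (gap B C)) \<ge> \<tau> * real (card B + card C)))}"


section \<open>Entropy\<close>

text \<open>The common refinement of the preimages of \<open>\<U>\<close> under the first \<open>n\<close> iterates of \<open>T\<close>,
  for a cover or partition \<open>\<U>\<close> of \<open>S\<close>.\<close>

definition iterated_join :: "'a set \<Rightarrow> ('a \<Rightarrow> 'a) \<Rightarrow> 'a set set \<Rightarrow> nat \<Rightarrow> 'a set set" where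
  "iterated_join S T \<U> n = {{x \<in> S. \<forall>k<n. (T ^^ k) x \<in> u k} | u. \<forall>k<n. u k \<in> \<U>}"

text \<open>Topological entropy of a continuous self-map of a compact space, defined through open
  covers (Adler, Konheim, McAndrew). The upper limits here and in the metric entropy are limits,
  by subadditivity.\<close>

definition open_cover :: "'a topology \<Rightarrow> 'a set set \<Rightarrow> bool" where
  "open_cover X \<U> \<longleftrightarrow> (\<forall>U\<in>\<U>. openin X U) \<and> \<Union>\<U> = topspace X"

definition subcover_number :: "'a set set \<Rightarrow> nat" where
  "subcover_number \<U> = (LEAST m. \<exists>\<V>\<subseteq>\<U>. finite \<V> \<and> card \<V> = m \<and> \<Union>\<V> = \<Union>\<U>)"

definition cover_entropy :: "'a topology \<Rightarrow> ('a \<Rightarrow> 'a) \<Rightarrow> 'a set set \<Rightarrow> ereal" where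
  "cover_entropy X T \<U> =
     limsup (\<lambda>n. ereal (ln (real (subcover_number (iterated_join (topspace X) T \<U> n))) / real n))"

definition topological_entropy :: "'a topology \<Rightarrow> ('a \<Rightarrow> 'a) \<Rightarrow> ereal" where
  "topological_entropy X T = (SUP \<U>\<in>{\<U>. open_cover X \<U>}. cover_entropy X T \<U>)"

text \<open>Kolmogorov--Sinai entropy. Empty cells contribute \<open>0\<close> because \<open>0 * ln 0 = 0\<close>.\<close>

definition partition_entropy :: "'a measure \<Rightarrow> 'a set set \<Rightarrow> real" where
  "partition_entropy M P = - (\<Sum>A\<in>P. measure M A * ln (measure M A))"

definition metric_entropy_partition :: "'a measure \<Rightarrow> ('a \<Rightarrow> 'a) \<Rightarrow> 'a set set \<Rightarrow> ereal" where
  "metric_entropy_partition M T P =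
     limsup (\<lambda>n. ereal (partition_entropy M (iterated_join (space M) T P n) / real n))"

definition metric_entropy :: "'a measure \<Rightarrow> ('a \<Rightarrow> 'a) \<Rightarrow> ereal" where
  "metric_entropy M T =
     (SUP P\<in>{P. finite P \<and> P \<subseteq> sets M \<and> partition_on (space M) P}. metric_entropy_partition M T P)"


section \<open>Measures of maximal entropy\<close>

definition invariant_measure :: "'a measure \<Rightarrow> ('a \<Rightarrow> 'a) \<Rightarrow> bool" where
  "invariant_measure M T \<longleftrightarrow> T \<in> measurable M M \<and> distr M M T = M"

text \<open>The topology on \<^typ>\<open>int \<Rightarrow> nat\<close> is the product of the discrete topologies,
  so it induces the cylinder topology on \<open>S\<close>.\<close>

definition measure_of_maximal_entropy ::
    "(int \<Rightarrow> nat) set \<Rightarrow> (int \<Rightarrow> nat) measure \<Rightarrow> bool" where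
  "measure_of_maximal_entropy S M \<longleftrightarrow>
     sets M = sets (restrict_space borel S) \<and> prob_space M \<and>
     invariant_measure M left_shift \<and>
     metric_entropy M left_shift = topological_entropy (top_of_set S) left_shift"

definition mutually_singular :: "'a measure \<Rightarrow> 'a measure \<Rightarrow> bool" where
  "mutually_singular M N \<longleftrightarrow>
     (\<exists>A. A \<in> sets M \<and> A \<in> sets N \<and> emeasure M A = 0 \<and> emeasure N (space N - A) = 0)"

end

(* There are \<nu>^n words of length n of either single colour, so the entropy of \<Sigma> is at
   least ln \<nu>, the entropy of the uniform Bernoulli measures on the green and on the yellow full
   shift.  Conversely, weigh every word of length n of \<Sigma> by \<nu>^(-n), so that zeros cost a factor 1/\<nu>
   each and coloured symbols are free.  As \<nu>^(-\<tau>) \<le> 1/3, a gap between blocks of lengths a and b has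
   weight at most 2 * 3^(-a-b), and summing over b and over the gap gives a contraction: the words
   starting with a block of length exactly a have total weight at most 3.  Hence there are only
   polynomially many times \<nu>^n words, the topological entropy is ln \<nu>, and both Bernoulli measures
   have maximal entropy; they are carried by disjoint sets. *)
theory Submission
  imports Defs
begin

section \<open>Admissibility is local\<close>

text \<open>Two obstacles shape the proof. Blocks may be infinite, and a finite window may cut them,
  so the gap condition cannot be read off a word as it stands. It is restated for arbitrary finite
  runs on both sides of a gap: the bound for whole blocks passes to shorter runs, and conversely the
  bound for all finite runs forces the blocks to be finite. In this form the condition is closed and
  survives cutting. The second obstacle is that metric entropy is a supremum over all finite
  measurable partitions, not only the one by symbols. Its upper bound is proved directly, without
  the variational principle. Every partition is guessed, outside a set of small measure, from
  finitely many coordinates. Gibbs' inequality then compares the law of the names with the law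
  obtained from a uniformly random window and a little noise. A window of about \<open>n\<close>
  symbols of \<open>A\<close> costs about \<open>n * ln (card A)\<close>; noise and wrong guesses
  cost arbitrarily little per step. As for the threshold: summing over the gap gives a factor 2 and
  summing \<open>3^(-b)\<close> gives 1/2, so the continuations weigh at most 1/3. The two colours
  of a block turn this into 2/3, which is still a contraction.\<close>

lemma colour_disjoint: "a \<in> green \<nu> \<Longrightarrow> a \<notin> yellow \<nu>"
  by (auto simp: green_def yellow_def)

lemma alphabet_nonzero_iff: "a \<in> alphabet \<nu> \<Longrightarrow> a \<noteq> 0 \<longleftrightarrow> a \<in> green \<nu> \<union> yellow \<nu>"
  by (auto simp: green_def yellow_def alphabet_def)

lemma colour_nonzero: "a \<in> green \<nu> \<union> yellow \<nu> \<Longrightarrow> a \<noteq> 0"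
  by (auto simp: green_def yellow_def)

lemma full_shift_alphabetD: "x \<in> full_shift A \<Longrightarrow> x i \<in> A"
  by (simp add: full_shift_def)

text \<open>Connectedness through nonzero symbols describes the block around \<open>i\<close>
  without naming its end points, so infinite blocks need no separate treatment. The
  \<open>min\<close> and \<open>max\<close> cover both directions at once.\<close>

definition component :: "(int \<Rightarrow> nat) \<Rightarrow> int \<Rightarrow> int set" where
  "component x i = {k. \<forall>t\<in>{min i k..max i k}. x t \<noteq> 0}"

lemma component_block:
  assumes x: "x \<in> full_shift (alphabet \<nu>)" and i: "x i \<noteq> 0"
  shows "coloured_block \<nu> x (component x i)"
  unfolding coloured_block_def
proof (intro conjI allI impI)
  have col: "x t \<in> green \<nu> \<union> yellow \<nu>" if "x t \<noteq> 0" for t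
    using alphabet_nonzero_iff[OF full_shift_alphabetD[OF x]] that by blast
  show "coloured_run \<nu> x (component x i)"
    unfolding coloured_run_def
  proof (intro conjI ballI)
    show "component x i \<noteq> {}"
      using i by (auto simp: component_def intro!: exI[of _ i])
    show "{a..b} \<subseteq> component x i" if "a \<in> component x i" "b \<in> component x i" for a b
    proof
      fix k assume k: "k \<in> {a..b}"
      have "x t \<noteq> 0" if t: "t \<in> {min i k..max i k}" for t
      proof -
        have "t \<in> {min i a..max i a} \<or> t \<in> {min i b..max i b}"
          using k t by auto
        then show ?thesis using \<open>a \<in> _\<close> \<open>b \<in> _\<close> by (auto simp: component_def)
      qed
      then show "k \<in> component x i" by (simp add: component_def)
    qed
    show "x k \<in> green \<nu> \<union> yellow \<nu>" if "k \<in> component x i" for k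
      using that by (intro col) (auto simp: component_def)
  qed
  fix C assume C: "coloured_run \<nu> x C \<and> component x i \<subseteq> C"
  have "i \<in> C" using C i by (auto simp: component_def)
  have "C \<subseteq> component x i"
  proof
    fix k assume k: "k \<in> C"
    have "{min i k..max i k} \<subseteq> C"
      using C k \<open>i \<in> C\<close> by (auto simp: coloured_run_def min_def max_def)
    then have "x t \<noteq> 0" if "t \<in> {min i k..max i k}" for t
      using that C colour_nonzero[of "x t"] unfolding coloured_run_def by blast
    then show "k \<in> component x i" by (simp add: component_def)
  qed
  then show "C = component x i" using C by blast
qed

lemma coloured_block_eq_component:
  assumes x: "x \<in> full_shift (alphabet \<nu>)" and B: "coloured_block \<nu> x B" and i: "i \<in> B"
  shows "B = component x i"
proof -
  have "x i \<noteq> 0"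
    using B i colour_nonzero unfolding coloured_block_def coloured_run_def by blast
  moreover have "B \<subseteq> component x i"
  proof
    fix k assume k: "k \<in> B"
    have "{min i k..max i k} \<subseteq> B"
      using B k i by (auto simp: coloured_block_def coloured_run_def min_def max_def)
    then have "x t \<noteq> 0" if "t \<in> {min i k..max i k}" for t
      using that B colour_nonzero[of "x t"] unfolding coloured_block_def coloured_run_def by blast
    then show "k \<in> component x i" by (simp add: component_def)
  qed
  ultimately show ?thesis
    using component_block[OF x] B unfolding coloured_block_def by blast
qed

text \<open>Finite windows decide membership in the shift; this gives both its closedness and the
  word count.\<close>

definition locally_admissible :: "nat \<Rightarrow> real \<Rightarrow> (int \<Rightarrow> nat) \<Rightarrow> bool" where
  "locally_admissible \<nu> \<tau> x \<longleftrightarrow>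
     (\<forall>i. x i \<in> alphabet \<nu>) \<and>
     (\<forall>i. x i \<noteq> 0 \<and> x (i + 1) \<noteq> 0 \<longrightarrow> (x i \<in> green \<nu> \<longleftrightarrow> x (i + 1) \<in> green \<nu>)) \<and>
     (\<forall>i j k l. i < j \<and> j < k \<and> k < l \<and>
        (\<forall>t\<in>{i..<j}. x t \<noteq> 0) \<and> (\<forall>t\<in>{j..<k}. x t = 0) \<and> (\<forall>t\<in>{k..<l}. x t \<noteq> 0) \<longrightarrow>
        (x (j - 1) \<in> green \<nu> \<longleftrightarrow> x k \<in> yellow \<nu>) \<and>
        \<tau> * real_of_int ((j - i) + (l - k)) \<le> real_of_int (k - j))"

lemma locally_admissibleI:
  assumes "\<And>i. x i \<in> alphabet \<nu>"
    and "\<And>i. x i \<noteq> 0 \<Longrightarrow> x (i + 1) \<noteq> 0 \<Longrightarrow> x i \<in> green \<nu> \<longleftrightarrow> x (i + 1) \<in> green \<nu>"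
    and "\<And>i j k l. i < j \<Longrightarrow> j < k \<Longrightarrow> k < l \<Longrightarrow> \<forall>t\<in>{i..<j}. x t \<noteq> 0 \<Longrightarrow>
        \<forall>t\<in>{j..<k}. x t = 0 \<Longrightarrow> \<forall>t\<in>{k..<l}. x t \<noteq> 0 \<Longrightarrow>
        (x (j - 1) \<in> green \<nu> \<longleftrightarrow> x k \<in> yellow \<nu>) \<and>
        \<tau> * real_of_int ((j - i) + (l - k)) \<le> real_of_int (k - j)"
  shows "locally_admissible \<nu> \<tau> x"
  unfolding locally_admissible_def using assms by blast

text \<open>A monochromatic sequence has no zeros, which makes the gap clause vacuous. Otherwise the
  runs before and after the zeros lie in the blocks around \<open>j - 1\<close> and
  \<open>k\<close>, whose gap is exactly \<open>{j..<k}\<close>. Replacing blocks by shorter runs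
  only weakens the bound because \<tau> is positive.\<close>

lemma two_coloured_imp_locally_admissible:
  assumes x: "x \<in> two_coloured_shift \<nu> \<tau>" and "\<tau> > 0"
  shows "locally_admissible \<nu> \<tau> x"
proof (cases "x \<in> full_shift (green \<nu>) \<union> full_shift (yellow \<nu>)")
  case True
  then have "x i \<noteq> 0" for i
    using colour_nonzero by (auto simp: full_shift_def)
  moreover have "x i \<in> green \<nu> \<longleftrightarrow> x j \<in> green \<nu>" for i j
    using True colour_disjoint by (auto simp: full_shift_def)
  moreover have "x i \<in> alphabet \<nu>" for i
    using x by (simp add: two_coloured_shift_def full_shift_def)
  ultimately show ?thesis
    unfolding locally_admissible_def by (metis atLeastLessThan_iff order_refl)
next
  case False
  have xA: "x \<in> full_shift (alphabet \<nu>)" using x by (simp add: two_coloured_shift_def)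
  have mono: "x ` B \<subseteq> green \<nu> \<or> x ` B \<subseteq> yellow \<nu>" if "coloured_block \<nu> x B" for B
    using x False that by (auto simp: two_coloured_shift_def)
  have succ: "(x ` B \<subseteq> green \<nu> \<and> x ` C \<subseteq> yellow \<nu> \<or> x ` B \<subseteq> yellow \<nu> \<and> x ` C \<subseteq> green \<nu>) \<and>
         finite B \<and> finite C \<and> real (card (gap B C)) \<ge> \<tau> * real (card B + card C)"
    if "successive_blocks \<nu> x B C" for B C
    using x False that unfolding two_coloured_shift_def by blast
  show ?thesis
  proof (rule locally_admissibleI, goal_cases)
    case (1 i)
    show ?case using xA by (simp add: full_shift_def)
  next
    case (2 i)
    have "{i, i + 1} \<subseteq> component x i"
    proof -
      have "{i..i+1} = {i, i+1}" by auto
      then show ?thesis using 2 by (auto simp: component_def)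
    qed
    then show ?case
      using mono[OF component_block[OF xA, of i]] 2 colour_disjoint by blast
  next
    case (3 i j k l)
    let ?B = "component x (j - 1)" and ?C = "component x k"
    have nz: "x (j - 1) \<noteq> 0" "x k \<noteq> 0" and z: "x j = 0" "x (k - 1) = 0" using 3 by auto
    have BC: "coloured_block \<nu> x ?B" "coloured_block \<nu> x ?C"
      using component_block[OF xA] nz by auto
    have Bs: "{i..<j} \<subseteq> ?B" "j - 1 \<in> ?B" and Cs: "{k..<l} \<subseteq> ?C" "k \<in> ?C"
      using 3 by (auto simp: component_def)
    have Bl: "b < j" if "b \<in> ?B" for b
    proof (rule ccontr)
      assume "\<not> b < j"
      then have "j \<in> {min (j - 1) b..max (j - 1) b}" by auto
      then show False using that z unfolding component_def by blast
    qed
    have Cl: "k \<le> c" if "c \<in> ?C" for c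
    proof (rule ccontr)
      assume "\<not> k \<le> c"
      then have "k - 1 \<in> {min k c..max k c}" by auto
      then show False using that z unfolding component_def by blast
    qed
    have gap: "gap ?B ?C = {j..<k}"
    proof
      show "gap ?B ?C \<subseteq> {j..<k}"
      proof
        fix t assume t: "t \<in> gap ?B ?C"
        have "j - 1 < t" "t < k"
          using t Bs(2) Cs(2) unfolding gap_def by blast+
        then show "t \<in> {j..<k}" by simp
      qed
      show "{j..<k} \<subseteq> gap ?B ?C"
        using Bl Cl unfolding gap_def by fastforce
    qed
    have "successive_blocks \<nu> x ?B ?C"
      unfolding successive_blocks_def gap using BC 3 Bl Cl by fastforce
    note s = succ[OF this]
    have "x (j - 1) \<in> green \<nu> \<longleftrightarrow> x k \<in> yellow \<nu>"
      using s Bs Cs colour_disjoint by blast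
    moreover have "\<tau> * real_of_int ((j - i) + (l - k)) \<le> real_of_int (k - j)"
    proof -
      have "nat (j - i) \<le> card ?B" "nat (l - k) \<le> card ?C"
        using card_mono[of ?B "{i..<j}"] card_mono[of ?C "{k..<l}"] s Bs Cs by auto
      then have "real_of_int ((j - i) + (l - k)) \<le> real (card ?B + card ?C)"
        using 3 by linarith
      then have "\<tau> * real_of_int ((j - i) + (l - k)) \<le> \<tau> * real (card ?B + card ?C)"
        using \<open>\<tau> > 0\<close> by (intro mult_left_mono) auto
      also have "\<dots> \<le> real (card {j..<k})" using s gap by simp
      finally show ?thesis using 3 by simp
    qed
    ultimately show ?case by blast
  qed
qed

text \<open>The inequality for all finite runs bounds the distance from the gap to any point of
  either block by the gap length divided by \<tau>. So both blocks are finite, and the inequality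
  can then be applied to the blocks themselves.\<close>

lemma locally_admissible_imp_two_coloured:
  assumes x: "locally_admissible \<nu> \<tau> x" and "\<tau> > 0"
  shows "x \<in> two_coloured_shift \<nu> \<tau>"
proof -
  have xA: "x \<in> full_shift (alphabet \<nu>)"
    using x by (simp add: locally_admissible_def full_shift_def)
  have adj: "x i \<in> green \<nu> \<longleftrightarrow> x (i + 1) \<in> green \<nu>" if "x i \<noteq> 0" "x (i + 1) \<noteq> 0" for i
    using x that by (simp add: locally_admissible_def)
  have far: "(x (j - 1) \<in> green \<nu> \<longleftrightarrow> x k \<in> yellow \<nu>) \<and>
        \<tau> * real_of_int ((j - i) + (l - k)) \<le> real_of_int (k - j)"
    if "i < j" "j < k" "k < l" "\<forall>t\<in>{i..<j}. x t \<noteq> 0" "\<forall>t\<in>{j..<k}. x t = 0"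
       "\<forall>t\<in>{k..<l}. x t \<noteq> 0" for i j k l
    using x that unfolding locally_admissible_def by blast
  have nzB: "x i \<noteq> 0" if "coloured_block \<nu> x B" "i \<in> B" for B i
    using that colour_nonzero unfolding coloured_block_def coloured_run_def by blast
  have ivl: "{i..j} \<subseteq> B" if "coloured_block \<nu> x B" "i \<in> B" "j \<in> B" for B i j
    using that unfolding coloured_block_def coloured_run_def by blast
  have run: "x i \<in> green \<nu> \<longleftrightarrow> x j \<in> green \<nu>"
    if "i \<le> j" "\<forall>t\<in>{i..j}. x t \<noteq> 0" for i j
    using that
  proof (induction j rule: int_ge_induct)
    case (step j)
    then show ?case using adj[of j] by auto
  qed simp
  have same: "x i \<in> green \<nu> \<longleftrightarrow> x j \<in> green \<nu>"
    if "coloured_block \<nu> x B" "i \<in> B" "j \<in> B" for B i j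
  proof (cases "i \<le> j")
    case True
    then show ?thesis using run[of i j] ivl[OF that] nzB[OF that(1)] by blast
  next
    case False
    then show ?thesis using run[of j i] ivl[OF that(1,3,2)] nzB[OF that(1)] by force
  qed
  have mono: "x ` B \<subseteq> green \<nu> \<or> x ` B \<subseteq> yellow \<nu>" if B: "coloured_block \<nu> x B" for B
    using same[OF B] B unfolding coloured_block_def coloured_run_def by blast
  have succ: "(x ` B \<subseteq> green \<nu> \<and> x ` C \<subseteq> yellow \<nu> \<or> x ` B \<subseteq> yellow \<nu> \<and> x ` C \<subseteq> green \<nu>) \<and>
         finite B \<and> finite C \<and> real (card (gap B C)) \<ge> \<tau> * real (card B + card C)"
    if s: "successive_blocks \<nu> x B C" for B C
  proof -
    have B: "coloured_block \<nu> x B" and C: "coloured_block \<nu> x C"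
      and lt: "\<And>b c. b \<in> B \<Longrightarrow> c \<in> C \<Longrightarrow> b < c" and zero: "\<And>t. t \<in> gap B C \<Longrightarrow> x t = 0"
      using s by (auto simp: successive_blocks_def)
    obtain b0 c0 where b0: "b0 \<in> B" and c0: "c0 \<in> C"
      using B C by (auto simp: coloured_block_def coloured_run_def)
    \<comment> \<open>The last position of \<open>B\<close>. Finiteness of \<open>B\<close> is not
      known yet, so the maximum is taken inside \<open>{b0..c0}\<close>; no point of
      \<open>B\<close> lies beyond \<open>c0\<close>.\<close>
    define p where "p = Max (B \<inter> {b0..c0})"
    have finp: "finite (B \<inter> {b0..c0})" by simp
    have nep: "B \<inter> {b0..c0} \<noteq> {}" using b0 lt[OF b0 c0] by auto
    have pB: "p \<in> B" using Max_in[OF finp nep] by (simp add: p_def)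
    have pmax: "b \<le> p" if "b \<in> B" for b
    proof (cases "b0 \<le> b")
      case True
      then show ?thesis using Max_ge[OF finp, of b] lt[OF that c0] that by (simp add: p_def)
    next
      case False
      have "b0 \<in> B \<inter> {b0..c0}" using lt[OF b0 c0] b0 by simp
      from Max_ge[OF finp this] show ?thesis using False by (simp add: p_def)
    qed
    define k where "k = Min (C \<inter> {b0..c0})"
    have fink: "finite (C \<inter> {b0..c0})" by simp
    have nek: "C \<inter> {b0..c0} \<noteq> {}" using c0 lt[OF b0 c0] by auto
    have kC: "k \<in> C" using Min_in[OF fink nek] by (simp add: k_def)
    have kmin: "k \<le> c" if "c \<in> C" for c
    proof (cases "c \<le> c0")
      case True
      then show ?thesis using Min_le[OF fink, of c] lt[OF b0 that] that by (simp add: k_def)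
    next
      case False
      have "c0 \<in> C \<inter> {b0..c0}" using lt[OF b0 c0] c0 by simp
      from Min_le[OF fink this] show ?thesis using False by (simp add: k_def)
    qed
    have gap: "gap B C = {p + 1..<k}"
    proof
      show "gap B C \<subseteq> {p + 1..<k}"
        using pB kC unfolding gap_def by fastforce
      show "{p + 1..<k} \<subseteq> gap B C"
        using pmax kmin unfolding gap_def by fastforce
    qed
    have pk: "p < k" using lt pB kC by blast
    \<comment> \<open>Without a zero in between, \<open>k\<close> would be connected to
      \<open>p\<close>, and the two blocks would be one.\<close>
    have "p + 1 \<noteq> k"
    proof
      assume e: "p + 1 = k"
      have "{p..k} = {p, k}" using e by auto
      then have "k \<in> component x p"
        using nzB[OF B pB] nzB[OF C kC] pk by (auto simp: component_def)
      then have "k \<in> B" using coloured_block_eq_component[OF xA B pB] by simp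
      then show False using pmax pk by fastforce
    qed
    then have jk: "p + 1 < k" using pk by simp
    have bound: "(x p \<in> green \<nu> \<longleftrightarrow> x k \<in> yellow \<nu>) \<and>
        \<tau> * real_of_int ((p + 1 - i) + (l + 1 - k)) \<le> real_of_int (k - (p + 1))"
      if i: "i \<in> B" and l: "l \<in> C" for i l
    proof -
      have "{i..<p+1} \<subseteq> B" using ivl[OF B i pB] by auto
      moreover have "{k..<l+1} \<subseteq> C" using ivl[OF C kC l] by auto
      ultimately show ?thesis
        using far[of i "p + 1" k "l + 1"] pmax[OF i] kmin[OF l] jk nzB[OF B] nzB[OF C] zero gap
        by fastforce
    qed
    have col: "x ` B \<subseteq> green \<nu> \<and> x ` C \<subseteq> yellow \<nu> \<or> x ` B \<subseteq> yellow \<nu> \<and> x ` C \<subseteq> green \<nu>"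
      using bound[OF pB kC] mono[OF B] mono[OF C] pB kC colour_disjoint by blast
    \<comment> \<open>The gap length divided by \<tau>, rounded up: a common bound for the extent of
      both blocks.\<close>
    define N where "N = \<lceil>real_of_int (k - (p + 1)) / \<tau>\<rceil>"
    have fit: "p + 1 - i + (l + 1 - k) \<le> N" if "i \<in> B" "l \<in> C" for i l
    proof -
      have "real_of_int ((p + 1 - i) + (l + 1 - k)) \<le> real_of_int (k - (p + 1)) / \<tau>"
        using bound[OF that] \<open>\<tau> > 0\<close> by (simp add: pos_le_divide_eq mult.commute)
      then show ?thesis unfolding N_def by linarith
    qed
    have "B \<subseteq> {p - N..p}" using fit[OF _ kC] pmax by fastforce
    then have fB: "finite B" by (rule finite_subset) simp
    have "C \<subseteq> {k..k + N}" using fit[OF pB] kmin by fastforce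
    then have fC: "finite C" by (rule finite_subset) simp
    have BI: "B \<subseteq> {Min B..<p + 1}" using fB pmax by force
    have CI: "C \<subseteq> {k..<Max C + 1}" using fC kmin by force
    have mB: "Min B \<in> B" and mC: "Max C \<in> C" using fB fC pB kC by (auto intro: Min_in Max_in)
    have "card B \<le> nat (p + 1 - Min B)" "card C \<le> nat (Max C + 1 - k)"
      using card_mono[OF _ BI] card_mono[OF _ CI] by auto
    moreover have "Min B \<le> p" "k \<le> Max C" using pmax[OF mB] kmin[OF mC] by auto
    ultimately have "real (card B + card C) \<le> real_of_int ((p + 1 - Min B) + (Max C + 1 - k))"
      by linarith
    then have "\<tau> * real (card B + card C) \<le> \<tau> * real_of_int ((p + 1 - Min B) + (Max C + 1 - k))"
      using \<open>\<tau> > 0\<close> by (intro mult_left_mono) auto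
    also have "\<dots> \<le> real_of_int (k - (p + 1))" using bound[OF mB mC] by simp
    also have "\<dots> = real (card (gap B C))" using jk by (simp add: gap)
    finally show ?thesis using col fB fC by simp
  qed
  show ?thesis
    unfolding two_coloured_shift_def using xA mono succ by blast
qed

lemma two_coloured_shift_eq:
  "\<tau> > 0 \<Longrightarrow> two_coloured_shift \<nu> \<tau> = {x. locally_admissible \<nu> \<tau> x}"
  using two_coloured_imp_locally_admissible locally_admissible_imp_two_coloured by blast

section \<open>Closedness, compactness and translation invariance of the two-coloured shift\<close>

lemma continuous_on_coordinate: "continuous_on S (\<lambda>x :: int \<Rightarrow> nat. x i)"
  by (rule continuous_on_product_coordinates[THEN continuous_on_subset]) simp

lemma open_coordinate: "open {x :: int \<Rightarrow> nat. P (x i)}"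
  using open_vimage[OF Topological_Spaces.open_discrete[of "Collect P"] continuous_on_coordinate[of UNIV i]]
  by (simp add: vimage_def)

lemma closed_coordinate: "closed {x :: int \<Rightarrow> nat. P (x i)}"
  using open_coordinate[of "\<lambda>a. \<not> P a" i] by (simp add: closed_def Collect_neg_eq)

lemma open_finite_window:
  "finite F \<Longrightarrow> open {x :: int \<Rightarrow> nat. \<forall>i\<in>F. P i (x i)}"
proof -
  assume "finite F"
  have "{x :: int \<Rightarrow> nat. \<forall>i\<in>F. P i (x i)} = (\<Inter>i\<in>F. {x. P i (x i)})" by auto
  then show ?thesis using \<open>finite F\<close> by (simp add: open_INT open_coordinate)
qed

text \<open>Each instance of local admissibility constrains finitely many coordinates. With discrete
  symbols its premise is an open condition and its conclusion a closed one, so the shift is an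
  intersection of closed sets.\<close>

lemma closed_two_coloured_shift:
  assumes "\<tau> > 0" shows "closed (two_coloured_shift \<nu> \<tau>)"
proof -
  have open3: "open {x :: int \<Rightarrow> nat. i < j \<and> j < k \<and> k < l \<and>
        (\<forall>t\<in>{i..<j}. x t \<noteq> 0) \<and> (\<forall>t\<in>{j..<k}. x t = 0) \<and> (\<forall>t\<in>{k..<l}. x t \<noteq> 0)}" for i j k l
    by (intro open_Collect_conj open_Collect_const open_finite_window) auto
  have iff: "closed {x :: int \<Rightarrow> nat. x i \<in> A \<longleftrightarrow> x j \<in> B}" for i j A B
    unfolding iff_conv_conj_imp
    by (intro closed_Collect_conj closed_Collect_imp open_coordinate closed_coordinate)
  show ?thesis
    unfolding two_coloured_shift_eq[OF assms] locally_admissible_def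
    by (intro closed_Collect_conj closed_Collect_all closed_Collect_imp open3 iff
        open_Collect_conj open_coordinate closed_coordinate closed_Collect_const)
qed

lemma compact_full_shift:
  assumes "finite A" shows "compact (full_shift A)"
proof -
  have "compactin (product_topology (\<lambda>i::int. euclidean) UNIV) (PiE UNIV (\<lambda>i. A))"
    using assms by (subst compactin_PiE) (auto simp: compactin_euclidean_iff finite_imp_compact)
  moreover have "PiE UNIV (\<lambda>i::int. A) = full_shift A"
    by (auto simp: full_shift_def PiE_def Pi_def)
  ultimately show ?thesis
    by (simp add: euclidean_product_topology compactin_euclidean_iff)
qed

lemma compact_two_coloured_shift:
  assumes "\<tau> > 0" shows "compact (two_coloured_shift \<nu> \<tau>)"
proof -
  have "finite (alphabet \<nu>)" by (simp add: alphabet_def green_def yellow_def)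
  moreover have "two_coloured_shift \<nu> \<tau> \<subseteq> full_shift (alphabet \<nu>)"
    by (auto simp: two_coloured_shift_def)
  ultimately show ?thesis
    using closed_Int_compact[OF closed_two_coloured_shift[OF assms] compact_full_shift]
    by (metis inf.absorb1)
qed

lemma two_coloured_shift_translate:
  assumes "\<tau> > 0" "x \<in> two_coloured_shift \<nu> \<tau>"
  shows "(\<lambda>i. x (i + s)) \<in> two_coloured_shift \<nu> \<tau>"
proof -
  have x: "locally_admissible \<nu> \<tau> x" using assms by (simp add: two_coloured_shift_eq)
  have sh: "(\<forall>t\<in>{i..<j}. P (x (t + s))) \<longleftrightarrow> (\<forall>t\<in>{i + s..<j + s}. P (x t))" for i j and P :: "nat \<Rightarrow> bool"
  proof
    assume *: "\<forall>t\<in>{i..<j}. P (x (t + s))"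
    show "\<forall>t\<in>{i + s..<j + s}. P (x t)"
    proof
      fix t assume "t \<in> {i + s..<j + s}"
      then show "P (x t)" using *[rule_format, of "t - s"] by auto
    qed
  qed auto
  have "locally_admissible \<nu> \<tau> (\<lambda>i. x (i + s))"
  proof (rule locally_admissibleI, goal_cases)
    case (1 i)
    then show ?case using x by (simp add: locally_admissible_def)
  next
    case (2 i)
    have "x (i + s) \<noteq> 0" "x (i + s + 1) \<noteq> 0" using 2 by (simp_all add: algebra_simps)
    then have "x (i + s) \<in> green \<nu> \<longleftrightarrow> x (i + s + 1) \<in> green \<nu>"
      using x by (simp add: locally_admissible_def)
    then show ?case by (simp add: algebra_simps)
  next
    case (3 i j k l)
    have "i + s < j + s" "j + s < k + s" "k + s < l + s"
      "\<forall>t\<in>{i + s..<j + s}. x t \<noteq> 0" "\<forall>t\<in>{j + s..<k + s}. x t = 0" "\<forall>t\<in>{k + s..<l + s}. x t \<noteq> 0"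
      using 3 sh[of i j "\<lambda>a. a \<noteq> 0"] sh[of j k "\<lambda>a. a = 0"] sh[of k l "\<lambda>a. a \<noteq> 0"] by auto
    then have "(x (j + s - 1) \<in> green \<nu> \<longleftrightarrow> x (k + s) \<in> yellow \<nu>) \<and>
        \<tau> * real_of_int ((j + s - (i + s)) + (l + s - (k + s))) \<le> real_of_int (k + s - (j + s))"
      using x unfolding locally_admissible_def by blast
    then show ?case by (simp add: algebra_simps)
  qed
  then show ?thesis using assms by (simp add: two_coloured_shift_eq)
qed

section \<open>Counting words\<close>

definition word :: "(int \<Rightarrow> nat) \<Rightarrow> nat \<Rightarrow> nat list" where
  "word x n = map (\<lambda>i. x (int i)) [0..<n]"

lemma length_word [simp]: "length (word x n) = n"
  by (simp add: word_def)

lemma nth_word [simp]: "i < n \<Longrightarrow> word x n ! i = x (int i)"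
  by (simp add: word_def)

lemma word_append: "word x (m + n) = word x m @ word (\<lambda>i. x (i + int m)) n"
proof (rule nth_equalityI)
  fix i assume "i < length (word x (m + n))"
  then show "word x (m + n) ! i = (word x m @ word (\<lambda>i. x (i + int m)) n) ! i"
    by (cases "i < m") (auto simp: nth_append)
qed simp

lemma word_zeros: "\<forall>t<n. x (int t) = 0 \<Longrightarrow> word x n = replicate n 0"
  by (rule nth_equalityI) auto

lemma locally_admissible_run_colour:
  assumes x: "locally_admissible \<nu> \<tau> x" and nz: "\<forall>t<b. x (int t) \<noteq> 0"
  shows "(\<forall>t<b. x (int t) \<in> green \<nu>) \<or> (\<forall>t<b. x (int t) \<in> yellow \<nu>)"
proof -
  have same: "x (int t) \<in> green \<nu> \<longleftrightarrow> x 0 \<in> green \<nu>" if "t < b" for t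
    using that
  proof (induction t)
    case (Suc t)
    have "x (int t) \<noteq> 0" "x (int t + 1) \<noteq> 0" using nz Suc.prems by (auto simp: algebra_simps dest: spec[of _ "Suc t"])
    then have "x (int t) \<in> green \<nu> \<longleftrightarrow> x (int t + 1) \<in> green \<nu>"
      using x by (simp add: locally_admissible_def)
    then show ?case using Suc by (simp add: algebra_simps)
  qed simp
  have "x (int t) \<in> green \<nu> \<union> yellow \<nu>" if "t < b" for t
    using alphabet_nonzero_iff[of "x (int t)" \<nu>] nz that x by (simp add: locally_admissible_def)
  then show ?thesis using same by blast
qed

text \<open>Maximality on the right is asserted only for \<open>l < n\<close>: a run that reaches
  the end of the window may have been cut there.\<close>

lemma first_run:
  fixes z :: "nat \<Rightarrow> nat"
  assumes "\<exists>t\<in>{a..<n}. z t \<noteq> 0"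
  shows "\<exists>k l. a \<le> k \<and> k < l \<and> l \<le> n \<and> (\<forall>t\<in>{a..<k}. z t = 0) \<and> (\<forall>t\<in>{k..<l}. z t \<noteq> 0) \<and>
           (l < n \<longrightarrow> z l = 0)"
proof -
  define k where "k = (LEAST t. a \<le> t \<and> z t \<noteq> 0)"
  obtain t0 where t0: "a \<le> t0" "z t0 \<noteq> 0" "t0 < n" using assms by auto
  have k: "a \<le> k" "z k \<noteq> 0" using LeastI[of "\<lambda>t. a \<le> t \<and> z t \<noteq> 0" t0] t0 by (auto simp: k_def)
  have kn: "k < n" using Least_le[of "\<lambda>t. a \<le> t \<and> z t \<noteq> 0" t0] t0 by (simp add: k_def)
  have kz: "z t = 0" if "a \<le> t" "t < k" for t
    using not_less_Least[of t "\<lambda>t. a \<le> t \<and> z t \<noteq> 0"] that by (auto simp: k_def)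
  define l where "l = (LEAST t. k < t \<and> (t = n \<or> z t = 0))"
  have l: "k < l" "l = n \<or> z l = 0"
    using LeastI[of "\<lambda>t. k < t \<and> (t = n \<or> z t = 0)" n] kn by (auto simp: l_def)
  have ln: "l \<le> n" using Least_le[of "\<lambda>t. k < t \<and> (t = n \<or> z t = 0)" n] kn by (simp add: l_def)
  have lz: "z t \<noteq> 0" if "k < t" "t < l" for t
    using not_less_Least[of t "\<lambda>t. k < t \<and> (t = n \<or> z t = 0)"] that by (auto simp: l_def)
  show ?thesis
  proof (rule exI[of _ k], rule exI[of _ l], intro conjI ballI impI)
    fix t assume "t \<in> {k..<l}"
    then show "z t \<noteq> 0" using lz[of t] k by (cases "t = k") auto
  qed (use k kn kz l ln in auto)
qed

section \<open>Words split according to their coloured blocks\<close>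

lemma real_le_add_sum:
  "(a :: nat) \<le> b + sum f I \<Longrightarrow> real a \<le> real b + (\<Sum>i\<in>I. real (f i))"
  by (simp flip: of_nat_sum of_nat_add)

lemma real_le_mult: "(a :: nat) \<le> b * c \<Longrightarrow> real a \<le> real b * real c"
  by (simp flip: of_nat_mult)

text \<open>The length \<open>a\<close> is the visible one. Position -1 is left free, so the block
  may begin before the window, and for \<open>a = n\<close> it may continue past its end. This makes
  the family stable under cutting a word at the start of a later block.\<close>

definition block_words :: "nat \<Rightarrow> real \<Rightarrow> nat \<Rightarrow> nat \<Rightarrow> nat list set" where
  "block_words \<nu> \<tau> a n =
     {word x n | x. x \<in> two_coloured_shift \<nu> \<tau> \<and>
        ((\<forall>t<a. x (int t) \<in> green \<nu>) \<or> (\<forall>t<a. x (int t) \<in> yellow \<nu>)) \<and> (a < n \<longrightarrow> x (int a) = 0)}"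

definition monochrome_words :: "nat \<Rightarrow> nat \<Rightarrow> nat list set" where
  "monochrome_words \<nu> a =
     {u. set u \<subseteq> green \<nu> \<and> length u = a} \<union> {u. set u \<subseteq> yellow \<nu> \<and> length u = a}"

lemma finite_monochrome_words: "finite (monochrome_words \<nu> a)"
  by (simp add: monochrome_words_def finite_lists_length_eq green_def yellow_def)

lemma card_monochrome_words: "card (monochrome_words \<nu> a) \<le> 2 * \<nu> ^ a"
proof -
  have "card (monochrome_words \<nu> a) \<le> card (green \<nu>) ^ a + card (yellow \<nu>) ^ a"
    unfolding monochrome_words_def
    by (rule order_trans[OF card_Un_le])
       (simp add: card_lists_length_eq green_def yellow_def)
  then show ?thesis by (simp add: green_def yellow_def mult_2)
qed

lemma finite_words: "finite ((\<lambda>x. word x n) ` two_coloured_shift \<nu> \<tau>)"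
proof (rule finite_subset)
  show "(\<lambda>x. word x n) ` two_coloured_shift \<nu> \<tau> \<subseteq> {u. set u \<subseteq> alphabet \<nu> \<and> length u = n}"
    by (auto simp: word_def two_coloured_shift_def full_shift_def)
  show "finite {u. set u \<subseteq> alphabet \<nu> \<and> length u = n}"
    by (rule finite_lists_length_eq) (simp add: alphabet_def green_def yellow_def)
qed

lemma finite_block_words: "finite (block_words \<nu> \<tau> a n)"
  by (rule finite_subset[OF _ finite_words[of n \<nu> \<tau>]]) (auto simp: block_words_def)

text \<open>Here \<open>k\<close> is the starting position and \<open>b\<close> the visible length
  of a second block behind a first one on \<open>{0..<a}\<close>. The condition \<open>a < k\<close>
  keeps the natural number subtraction honest.\<close>

definition next_blocks :: "real \<Rightarrow> nat \<Rightarrow> nat \<Rightarrow> (nat \<times> nat) set" where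
  "next_blocks \<tau> a n =
     {(k, b). a < k \<and> 1 \<le> b \<and> k + b \<le> n \<and> \<tau> * real (a + b) \<le> real (k - a)}"

lemma finite_next_blocks: "finite (next_blocks \<tau> a n)"
  by (rule finite_subset[of _ "{..n} \<times> {..n}"]) (auto simp: next_blocks_def)

lemma word_monochrome:
  assumes "(\<forall>t<a. x (int t) \<in> green \<nu>) \<or> (\<forall>t<a. x (int t) \<in> yellow \<nu>)"
  shows "word x a \<in> monochrome_words \<nu> a"
  using assms by (auto simp: monochrome_words_def word_def)

lemma block_words_full: "block_words \<nu> \<tau> n n \<subseteq> monochrome_words \<nu> n"
  using word_monochrome by (auto simp: block_words_def)

text \<open>The renewal step of the count: after the first block come either zeros up to the end, or
  zeros up to a second block, from which on the shifted sequence again gives a block word. That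
  colours must alternate is forgotten, which costs at most a factor 2 per block. The gap condition
  for the visible runs is the local one, so a cut second block is no problem.\<close>

lemma block_words_decomp:
  assumes a: "1 \<le> a" "a < n" and \<tau>: "\<tau> > 0"
  shows "block_words \<nu> \<tau> a n \<subseteq>
      (\<lambda>u. u @ replicate (n - a) 0) ` monochrome_words \<nu> a \<union>
      (\<Union>(k, b)\<in>next_blocks \<tau> a n.
         (\<lambda>(u, v). u @ replicate (k - a) 0 @ v) ` (monochrome_words \<nu> a \<times> block_words \<nu> \<tau> b (n - k)))"
proof
  fix w assume "w \<in> block_words \<nu> \<tau> a n"
  then obtain x where w: "w = word x n" and x: "x \<in> two_coloured_shift \<nu> \<tau>"
    and col: "(\<forall>t<a. x (int t) \<in> green \<nu>) \<or> (\<forall>t<a. x (int t) \<in> yellow \<nu>)" and z: "x (int a) = 0"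
    using a by (auto simp: block_words_def)
  have mono: "word x a \<in> monochrome_words \<nu> a" using word_monochrome[OF col] .
  show "w \<in> (\<lambda>u. u @ replicate (n - a) 0) ` monochrome_words \<nu> a \<union>
      (\<Union>(k, b)\<in>next_blocks \<tau> a n.
         (\<lambda>(u, v). u @ replicate (k - a) 0 @ v) ` (monochrome_words \<nu> a \<times> block_words \<nu> \<tau> b (n - k)))"
  proof (cases "\<exists>t\<in>{a..<n}. x (int t) \<noteq> 0")
    case False
    have "word x n = word x a @ word (\<lambda>i. x (i + int a)) (n - a)"
      using word_append[of x a "n - a"] a by simp
    also have "word (\<lambda>i. x (i + int a)) (n - a) = replicate (n - a) 0"
    proof (rule word_zeros, intro allI impI)
      fix t assume "t < n - a"
      then have "t + a \<in> {a..<n}" using a by auto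
      then show "x (int t + int a) = 0" using False by (metis of_nat_add)
    qed
    finally have "w = word x a @ replicate (n - a) 0" using w by simp
    then show ?thesis using mono by blast
  next
    case True
    then obtain k l where kl: "a \<le> k" "k < l" "l \<le> n" "\<forall>t\<in>{a..<k}. x (int t) = 0"
      "\<forall>t\<in>{k..<l}. x (int t) \<noteq> 0" "l < n \<longrightarrow> x (int l) = 0"
      using first_run[of a n "\<lambda>t. x (int t)"] by blast
    have "x (int k) \<noteq> 0" using kl(2,5) by simp
    then have "k \<noteq> a" using z by auto
    then have ak: "a < k" using kl by simp
    define y where "y = (\<lambda>i. x (i + int k))"
    define b where "b = l - k"
    have y: "y \<in> two_coloured_shift \<nu> \<tau>"
      unfolding y_def by (rule two_coloured_shift_translate[OF \<tau> x])
    have la: "locally_admissible \<nu> \<tau> x" "locally_admissible \<nu> \<tau> y"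
      using two_coloured_imp_locally_admissible x y \<tau> by blast+
    have ynz: "y (int t) \<noteq> 0" if "t < b" for t
      using kl(5)[rule_format, of "t + k"] that by (simp add: y_def b_def)
    have ycol: "(\<forall>t<b. y (int t) \<in> green \<nu>) \<or> (\<forall>t<b. y (int t) \<in> yellow \<nu>)"
      by (rule locally_admissible_run_colour[OF la(2)]) (use ynz in blast)
    have yend: "b < n - k \<longrightarrow> y (int b) = 0"
      using kl by (auto simp: y_def b_def)
    have v: "word y (n - k) \<in> block_words \<nu> \<tau> b (n - k)"
      unfolding block_words_def using y ycol yend by blast
    have "word x n = word x a @ word (\<lambda>i. x (i + int a)) (n - a)"
      using word_append[of x a "n - a"] a by simp
    also have "word (\<lambda>i. x (i + int a)) (n - a) =
        word (\<lambda>i. x (i + int a)) (k - a) @ word y (n - k)"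
      using word_append[of "\<lambda>i. x (i + int a)" "k - a" "n - k"] kl ak
      by (simp add: y_def algebra_simps)
    also have "word (\<lambda>i. x (i + int a)) (k - a) = replicate (k - a) 0"
    proof (rule word_zeros, intro allI impI)
      fix t assume "t < k - a"
      then have "t + a \<in> {a..<k}" using ak by auto
      then show "x (int t + int a) = 0" using kl(4) by (metis of_nat_add)
    qed
    finally have weq: "w = word x a @ replicate (k - a) 0 @ word y (n - k)" using w by simp
    have "\<tau> * real_of_int ((int a - 0) + (int l - int k)) \<le> real_of_int (int k - int a)"
    proof -
      have nza: "\<forall>t\<in>{0..<int a}. x t \<noteq> 0"
      proof
        fix t assume "t \<in> {0..<int a}"
        then have "t = int (nat t)" "nat t < a" by auto
        then show "x t \<noteq> 0" using col colour_nonzero by (metis UnI1 UnI2)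
      qed
      have zz: "\<forall>t\<in>{int a..<int k}. x t = 0"
      proof
        fix t assume "t \<in> {int a..<int k}"
        then have "t = int (nat t)" "nat t \<in> {a..<k}" by auto
        then show "x t = 0" using kl(4) by metis
      qed
      have nzl: "\<forall>t\<in>{int k..<int l}. x t \<noteq> 0"
      proof
        fix t assume "t \<in> {int k..<int l}"
        then have "t = int (nat t)" "nat t \<in> {k..<l}" by auto
        then show "x t \<noteq> 0" using kl(5) by metis
      qed
      have "0 < int a" "int a < int k" "int k < int l" using a ak kl by auto
      then show ?thesis
        using la(1) nza zz nzl unfolding locally_admissible_def by blast
    qed
    moreover have "real_of_int ((int a - 0) + (int l - int k)) = real (a + b)"
        "real_of_int (int k - int a) = real (k - a)"
      using kl(2) ak by (auto simp: b_def of_nat_diff)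
    ultimately have "\<tau> * real (a + b) \<le> real (k - a)" by metis
    moreover have "1 \<le> b" "k + b \<le> n" using kl by (auto simp: b_def)
    ultimately have "(k, b) \<in> next_blocks \<tau> a n"
      using ak unfolding next_blocks_def by blast
    then show ?thesis using weq mono v by force
  qed
qed

text \<open>The exponents are distinct and at least the ceiling of \<open>s\<close>, so the sum is
  dominated by a geometric tail. Its ratio is at most 1/2, hence the factor 2.\<close>

lemma sum_inverse_powers_le:
  fixes \<nu> :: nat
  assumes \<nu>: "\<nu> \<ge> 2" and L: "finite L" "\<And>k. k \<in> L \<Longrightarrow> s \<le> real k" and "s \<ge> 0"
  shows "(\<Sum>k\<in>L. (1 / real \<nu>) ^ k) \<le> 2 * real \<nu> powr (- s)"
proof -
  define m where "m = nat \<lceil>s\<rceil>"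
  obtain N where N: "L \<subseteq> {..<N}" using L(1) finite_nat_iff_bounded by blast
  have m: "m \<le> k" if "k \<in> L" for k using L(2)[OF that] unfolding m_def by linarith
  have "(\<Sum>k\<in>L. (1 / real \<nu>) ^ k) \<le> (\<Sum>k\<in>{m..<m + N}. (1 / real \<nu>) ^ k)"
    using N m by (intro sum_mono2) (auto dest: subsetD)
  also have "\<dots> = (\<Sum>i<N. (1 / real \<nu>) ^ (m + i))"
    by (rule sum.reindex_bij_witness[of _ "\<lambda>i. m + i" "\<lambda>k. k - m"]) auto
  also have "\<dots> = (1 / real \<nu>) ^ m * (\<Sum>i<N. (1 / real \<nu>) ^ i)"
    by (simp add: power_add sum_distrib_left)
  also have "(\<Sum>i<N. (1 / real \<nu>) ^ i) \<le> (\<Sum>i<N. (1 / 2) ^ i)"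
    using \<nu> by (intro sum_mono power_mono) (auto simp: field_simps)
  also have "(\<Sum>i<N. (1 / 2 :: real) ^ i) = 2 - 2 * (1 / 2) ^ N"
    by (induction N) auto
  also have "\<dots> \<le> (2 :: real)" by simp
  finally have "(\<Sum>k\<in>L. (1 / real \<nu>) ^ k) \<le> (1 / real \<nu>) ^ m * 2"
    by (simp add: mult_left_mono)
  also have "(1 / real \<nu>) ^ m = real \<nu> powr (- real m)"
    using \<nu> by (simp add: powr_minus powr_realpow power_one_over inverse_eq_divide)
  also have "\<dots> \<le> real \<nu> powr (- s)"
    using \<nu> unfolding m_def by (intro powr_mono) (auto, linarith)
  finally show ?thesis by simp
qed

lemma sum_third_powers_le: "(\<Sum>b=1..n. (1 / 3 :: real) ^ b) \<le> 1 / 2"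
proof -
  have "(\<Sum>b=1..n. (1 / 3 :: real) ^ b) = 1 / 2 - (1 / 3) ^ n / 2"
    by (induction n) auto
  then show ?thesis by simp
qed

text \<open>The hypothesis on \<tau> says \<open>\<nu> powr (-\<tau>) \<le> 1/3\<close>. For fixed
  \<open>b\<close> the geometric tail over the gap is therefore at most
  \<open>2 * (1/3)^(a + b)\<close>. The factor 2 cancels against the sum of \<open>(1/3)^b\<close>
  over \<open>b \<ge> 1\<close>, leaving \<open>(1/3)^a\<close>; here \<open>a \<ge> 1\<close> is
  what yields 1/3.\<close>

lemma next_blocks_weight:
  assumes \<nu>: "\<nu> \<ge> 2" and \<tau>: "\<tau> > 0" "\<tau> \<ge> ln 3 / ln (real \<nu>)" and a: "a \<ge> 1"
  shows "(\<Sum>(k, b)\<in>next_blocks \<tau> a n. (1 / real \<nu>) ^ (k - a)) \<le> 1 / 3"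
proof -
  define K where "K b = {k. a < k \<and> k \<le> n \<and> \<tau> * real (a + b) \<le> real (k - a)}" for b
  have lnpos: "ln (real \<nu>) > 0" using \<nu> by simp
  have tail: "(\<Sum>k\<in>K b. (1 / real \<nu>) ^ (k - a)) \<le> 2 * (1 / 3) ^ (a + b)" for b
  proof -
    have "(\<Sum>k\<in>K b. (1 / real \<nu>) ^ (k - a)) = (\<Sum>d\<in>(\<lambda>k. k - a) ` K b. (1 / real \<nu>) ^ d)"
      by (subst sum.reindex) (auto simp: K_def inj_on_def)
    also have "\<dots> \<le> 2 * real \<nu> powr (- (\<tau> * real (a + b)))"
      using \<nu> \<tau> by (intro sum_inverse_powers_le) (auto simp: K_def)
    also have "real \<nu> powr (- (\<tau> * real (a + b))) = exp (- (\<tau> * ln (real \<nu>)) * real (a + b))"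
      using \<nu> by (simp add: powr_def algebra_simps)
    also have "\<dots> \<le> exp (- ln 3 * real (a + b))"
      using \<tau>(2) lnpos by (intro iffD2[OF exp_le_cancel_iff] mult_right_mono) (auto simp: field_simps)
    also have "\<dots> = (1 / 3) ^ (a + b)"
    proof -
      have "exp (- ln 3 * real (a + b)) = exp (- ln 3 :: real) ^ (a + b)"
        by (subst exp_of_nat_mult[symmetric]) (simp add: mult.commute)
      then show ?thesis by (simp add: exp_minus inverse_eq_divide)
    qed
    finally show ?thesis by simp
  qed
  \<comment> \<open>The order of summation is exchanged so that the gap is summed first. Relaxing
    \<open>k + b \<le> n\<close> to \<open>k \<le> n\<close> and \<open>b \<le> n\<close> only adds
    nonnegative terms.\<close>
  have "(\<Sum>(k, b)\<in>next_blocks \<tau> a n. (1 / real \<nu>) ^ (k - a))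
      \<le> (\<Sum>(b, k)\<in>Sigma {1..n} K. (1 / real \<nu>) ^ (k - a))"
  proof -
    have "(\<Sum>(k, b)\<in>next_blocks \<tau> a n. (1 / real \<nu>) ^ (k - a)) =
        (\<Sum>(b, k)\<in>prod.swap ` next_blocks \<tau> a n. (1 / real \<nu>) ^ (k - a))"
      by (subst sum.reindex) (auto simp: case_prod_unfold)
    also have "\<dots> \<le> (\<Sum>(b, k)\<in>Sigma {1..n} K. (1 / real \<nu>) ^ (k - a))"
    proof (rule sum_mono2)
      have "finite (K b)" for b by (rule finite_subset[of _ "{..n}"]) (auto simp: K_def)
      then show "finite (Sigma {1..n} K)" by blast
      show "prod.swap ` next_blocks \<tau> a n \<subseteq> Sigma {1..n} K"
        by (auto simp: K_def next_blocks_def)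
    qed auto
    finally show ?thesis .
  qed
  also have "\<dots> = (\<Sum>b=1..n. \<Sum>k\<in>K b. (1 / real \<nu>) ^ (k - a))"
    by (subst sum.Sigma) (auto simp: K_def)
  also have "\<dots> \<le> (\<Sum>b=1..n. 2 * (1 / 3) ^ (a + b))" by (intro sum_mono tail)
  also have "\<dots> = 2 * (1 / 3) ^ a * (\<Sum>b=1..n. (1 / 3) ^ b)"
    by (simp add: power_add sum_distrib_left mult.assoc)
  also have "\<dots> \<le> 2 * (1 / 3) ^ a * (1 / 2)"
    by (intro mult_left_mono sum_third_powers_le) auto
  also have "\<dots> \<le> 1 / 3"
    using a power_decreasing[of 1 a "1 / 3 :: real"] by simp
  finally show ?thesis .
qed

text \<open>The constant 3 solves \<open>C = 1 + 2 * C * (1/3)\<close>: the 1 accounts for words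
  without a second block, the 2 for the colour of the first block, and 1/3 for the total weight of
  the gaps.\<close>

lemma card_block_words:
  assumes \<nu>: "\<nu> \<ge> 2" and \<tau>: "\<tau> > 0" "\<tau> \<ge> ln 3 / ln (real \<nu>)"
  shows "1 \<le> a \<Longrightarrow> a \<le> n \<Longrightarrow> real (card (block_words \<nu> \<tau> a n)) \<le> 3 * real \<nu> ^ n"
proof (induction n arbitrary: a rule: less_induct)
  case (less n)
  let ?W = "block_words \<nu> \<tau>" and ?U = "monochrome_words \<nu>"
  have U: "real (card (?U m)) \<le> 2 * real \<nu> ^ m" for m
    using card_monochrome_words[of \<nu> m] by (metis of_nat_le_iff of_nat_mult of_nat_numeral of_nat_power)
  show ?case
  proof (cases "a = n")
    case True
    have "real (card (?W n n)) \<le> real (card (?U n))"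
      using card_mono[OF finite_monochrome_words block_words_full] by simp
    also have "\<dots> \<le> 3 * real \<nu> ^ n" using U[of n] by (rule order_trans) simp
    finally show ?thesis using True by simp
  next
    case False
    then have an: "a < n" using less.prems by simp
    let ?I = "next_blocks \<tau> a n"
    let ?X = "(\<lambda>u. u @ replicate (n - a) (0::nat)) ` ?U a"
    let ?Y = "\<lambda>(k, b). (\<lambda>(u, v). u @ replicate (k - a) (0::nat) @ v) ` (?U a \<times> ?W b (n - k))"
    have fX: "finite ?X" by (intro finite_imageI finite_monochrome_words)
    have fY: "finite (?Y p)" for p
      by (cases p) (auto intro!: finite_imageI finite_cartesian_product finite_monochrome_words finite_block_words)
    have "card (?W a n) \<le> card (?X \<union> (\<Union>p\<in>?I. ?Y p))"
      using block_words_decomp[OF less.prems(1) an \<tau>(1), of \<nu>] fX fY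
      by (intro card_mono) (auto simp: finite_next_blocks)
    also have "\<dots> \<le> card ?X + (\<Sum>p\<in>?I. card (?Y p))"
      by (rule order_trans[OF card_Un_le]) (intro add_left_mono card_UN_le finite_next_blocks)
    finally have "real (card (?W a n)) \<le> real (card ?X) + (\<Sum>p\<in>?I. real (card (?Y p)))"
      by (rule real_le_add_sum)
    \<comment> \<open>At least one zero follows the block, because \<open>a < n\<close>. Its lost
      factor \<nu> is at least 2 and pays for the two colours.\<close>
    also have "real (card ?X) \<le> real \<nu> ^ n"
    proof -
      have "real (card ?X) \<le> real (card (?U a))"
        using card_image_le[OF finite_monochrome_words] by simp
      also have "\<dots> \<le> 2 * real \<nu> ^ a" by (rule U)
      also have "\<dots> \<le> real \<nu> ^ Suc a" using \<nu> by (simp add: mult_right_mono)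
      also have "\<dots> \<le> real \<nu> ^ n" using \<nu> an by (intro power_increasing) auto
      finally show ?thesis .
    qed
    also have "(\<Sum>p\<in>?I. real (card (?Y p))) \<le>
        (\<Sum>(k, b)\<in>?I. 6 * real \<nu> ^ n * (1 / real \<nu>) ^ (k - a))"
    proof (rule sum_mono)
      fix p assume p: "p \<in> ?I"
      obtain k b where kb: "p = (k, b)" by fastforce
      then have kb': "a < k" "1 \<le> b" "b \<le> n - k" "k \<le> n" using p by (auto simp: next_blocks_def)
      have "card (?Y (k, b)) \<le> card (?U a) * card (?W b (n - k))"
        using card_image_le[of "?U a \<times> ?W b (n - k)" "\<lambda>(u, v). u @ replicate (k - a) (0::nat) @ v"]
        by (simp add: finite_monochrome_words finite_block_words card_cartesian_product)
      then have "real (card (?Y (k, b))) \<le> real (card (?U a)) * real (card (?W b (n - k)))"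
        by (rule real_le_mult)
      also have "\<dots> \<le> (2 * real \<nu> ^ a) * (3 * real \<nu> ^ (n - k))"
        using less.IH[of "n - k" b] kb' by (intro mult_mono U) auto
      also have "\<dots> = 6 * real \<nu> ^ n * (1 / real \<nu>) ^ (k - a)"
      proof -
        \<comment> \<open>The \<open>k - a\<close> zeros of the gap admit one choice each instead of
          \<nu>; this is the source of the weight \<open>(1 / \<nu>) ^ (k - a)\<close>.\<close>
        have "n = a + (n - k) + (k - a)" using kb' by simp
        then have "real \<nu> ^ n = real \<nu> ^ a * real \<nu> ^ (n - k) * real \<nu> ^ (k - a)"
          by (metis power_add)
        then show ?thesis using \<nu> by (simp add: power_one_over)
      qed
      finally show "real (card (?Y p)) \<le> (case p of (k, b) \<Rightarrow> 6 * real \<nu> ^ n * (1 / real \<nu>) ^ (k - a))"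
        unfolding kb by simp
    qed
    also have "(\<Sum>(k, b)\<in>?I. 6 * real \<nu> ^ n * (1 / real \<nu>) ^ (k - a)) =
        6 * real \<nu> ^ n * (\<Sum>(k, b)\<in>?I. (1 / real \<nu>) ^ (k - a))"
      by (simp add: sum_distrib_left case_prod_unfold)
    also have "\<dots> \<le> 6 * real \<nu> ^ n * (1 / 3)"
      by (intro mult_left_mono next_blocks_weight assms less.prems) auto
    finally show ?thesis by simp
  qed
qed

text \<open>A nonzero word is determined by the start \<open>k\<close> of its first run, the visible
  length \<open>b\<close> of that run and a block word of length \<open>n - k\<close>. There are at
  most \<open>n^2\<close> pairs \<open>(k, b)\<close>. Such a polynomial factor is harmless for
  entropy, so the gain from the leading zeros is given away.\<close>

lemma card_words:
  assumes \<nu>: "\<nu> \<ge> 2" and \<tau>: "\<tau> > 0" "\<tau> \<ge> ln 3 / ln (real \<nu>)"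
  shows "real (card ((\<lambda>x. word x n) ` two_coloured_shift \<nu> \<tau>)) \<le> (3 * real n ^ 2 + 1) * real \<nu> ^ n"
proof -
  let ?S = "two_coloured_shift \<nu> \<tau>"
  let ?I = "{(k, b). 1 \<le> b \<and> k + b \<le> n}"
  let ?Y = "\<lambda>(k, b). (\<lambda>v. replicate k (0::nat) @ v) ` block_words \<nu> \<tau> b (n - k)"
  have I: "?I \<subseteq> {..<n} \<times> {1..n}" by auto
  have fI: "finite ?I" using finite_subset[OF I] by simp
  have fY: "finite (?Y p)" for p
    by (cases p) (auto intro!: finite_imageI finite_block_words)
  have "(\<lambda>x. word x n) ` ?S \<subseteq> {replicate n 0} \<union> (\<Union>p\<in>?I. ?Y p)"
  proof (rule image_subsetI)
    fix x assume x: "x \<in> ?S"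
    show "word x n \<in> {replicate n 0} \<union> (\<Union>p\<in>?I. ?Y p)"
    proof (cases "\<exists>t\<in>{0..<n}. x (int t) \<noteq> 0")
      case False
      then show ?thesis using word_zeros[of n x] by auto
    next
      case True
      then obtain k l where kl: "k < l" "l \<le> n" "\<forall>t\<in>{0..<k}. x (int t) = 0"
        "\<forall>t\<in>{k..<l}. x (int t) \<noteq> 0" "l < n \<longrightarrow> x (int l) = 0"
        using first_run[of 0 n "\<lambda>t. x (int t)"] by blast
      define y where "y = (\<lambda>i. x (i + int k))"
      define b where "b = l - k"
      have y: "y \<in> ?S"
        unfolding y_def by (rule two_coloured_shift_translate[OF \<tau>(1) x])
      have ynz: "y (int t) \<noteq> 0" if "t < b" for t
        using kl(4)[rule_format, of "t + k"] that by (simp add: y_def b_def)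
      have ycol: "(\<forall>t<b. y (int t) \<in> green \<nu>) \<or> (\<forall>t<b. y (int t) \<in> yellow \<nu>)"
        by (rule locally_admissible_run_colour[OF two_coloured_imp_locally_admissible[OF y \<tau>(1)]])
           (use ynz in blast)
      have yend: "b < n - k \<longrightarrow> y (int b) = 0"
        using kl by (auto simp: y_def b_def)
      have v: "word y (n - k) \<in> block_words \<nu> \<tau> b (n - k)"
        unfolding block_words_def using y ycol yend by blast
      have "word x n = word x k @ word y (n - k)"
        using word_append[of x k "n - k"] kl by (simp add: y_def)
      moreover have "word x k = replicate k 0" using kl by (intro word_zeros) auto
      moreover have "(k, b) \<in> ?I" using kl by (auto simp: b_def)
      ultimately show ?thesis using v by force
    qed
  qed
  then have "card ((\<lambda>x. word x n) ` ?S) \<le> card ({replicate n 0} \<union> (\<Union>p\<in>?I. ?Y p))"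
    using fI fY by (intro card_mono) auto
  also have "\<dots> \<le> card {replicate n (0::nat)} + (\<Sum>p\<in>?I. card (?Y p))"
    by (rule order_trans[OF card_Un_le]) (intro add_left_mono card_UN_le fI)
  finally have "real (card ((\<lambda>x. word x n) ` ?S)) \<le>
      real (card {replicate n (0::nat)}) + (\<Sum>p\<in>?I. real (card (?Y p)))"
    by (rule real_le_add_sum)
  also have "(\<Sum>p\<in>?I. real (card (?Y p))) \<le> (\<Sum>p\<in>?I. 3 * real \<nu> ^ n)"
  proof (rule sum_mono)
    fix p assume p: "p \<in> ?I"
    obtain k b where kb': "p = (k, b)" by fastforce
    then have kb: "1 \<le> b" "k + b \<le> n" using p by auto
    have "real (card (?Y (k, b))) \<le> real (card (block_words \<nu> \<tau> b (n - k)))"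
      using card_image_le[OF finite_block_words] by simp
    also have "\<dots> \<le> 3 * real \<nu> ^ (n - k)"
      using kb by (intro card_block_words assms) auto
    also have "\<dots> \<le> 3 * real \<nu> ^ n"
      using \<nu> by (intro mult_left_mono power_increasing) auto
    finally show "real (card (?Y p)) \<le> 3 * real \<nu> ^ n" unfolding kb' .
  qed
  also have "\<dots> \<le> real n ^ 2 * (3 * real \<nu> ^ n)"
  proof -
    have "card ?I \<le> n * n" using card_mono[OF _ I] by simp
    then have "real (card ?I) \<le> real n ^ 2"
      unfolding power2_eq_square by (rule real_le_mult)
    then show ?thesis by (simp add: mult_right_mono)
  qed
  also have "real (card {replicate n (0::nat)}) + real n ^ 2 * (3 * real \<nu> ^ n) \<le> (3 * real n ^ 2 + 1) * real \<nu> ^ n"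
    using \<nu> by (simp add: algebra_simps)
  finally show ?thesis by simp
qed

section \<open>Metric entropy of measures supported on a full shift\<close>

lemma left_shift_funpow: "(left_shift ^^ n) x = (\<lambda>i. x (i + int n))"
  by (induction n arbitrary: x) (auto simp: left_shift_def algebra_simps funpow_swap1)

section \<open>Approximation of measurable sets and partitions by cylinders\<close>

definition agree :: "nat \<Rightarrow> (int \<Rightarrow> nat) \<Rightarrow> (int \<Rightarrow> nat) \<Rightarrow> bool" where
  "agree m x y \<longleftrightarrow> (\<forall>i\<in>{-int m..int m}. x i = y i)"

lemma agree_mono: "agree m x y \<Longrightarrow> m' \<le> m \<Longrightarrow> agree m' x y"
  by (auto simp: agree_def)

lemma agree_sym: "agree m x y \<Longrightarrow> agree m y x"
  by (auto simp: agree_def)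

lemma open_agree: "open {y. agree m x y}"
  using open_finite_window[of "{-int m..int m}" "\<lambda>i a. x i = a"] by (simp add: agree_def)

lemma open_if_agree_closed:
  assumes "\<And>x y. agree m x y \<Longrightarrow> x \<in> C \<Longrightarrow> y \<in> C" shows "open C"
proof (subst open_subopen, intro ballI)
  fix x assume "x \<in> C"
  then show "\<exists>T. open T \<and> x \<in> T \<and> T \<subseteq> C"
    using assms open_agree[of m x] by (intro exI[of _ "{y. agree m x y}"]) (auto simp: agree_def)
qed

text \<open>The approximable sets form a sigma-algebra that contains the one-coordinate sets
  generating the Borel sets. For a countable union, continuity from below reduces to finitely many
  members at a cost of \<open>e / 2\<close>; approximating these members costs the other
  half.\<close>

lemma cylinder_approx:
  fixes M :: "(int \<Rightarrow> nat) measure"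
  assumes M: "finite_measure M" "sets M = sets (restrict_space borel S)"
    and B: "B \<in> sets borel" and e: "e > 0"
  shows "\<exists>m C. (\<forall>x y. agree m x y \<longrightarrow> x \<in> C \<longrightarrow> y \<in> C) \<and> measure M (S \<inter> sym_diff B C) < e"
proof -
  interpret finite_measure M by fact
  let ?G = "{{f :: int \<Rightarrow> nat. f i \<in> A} | i A. A \<in> sets borel}"
  have sigma: "sigma_sets UNIV ?G = sets borel"
    using sets_PiM_single[of "UNIV :: int set" "\<lambda>_. borel :: nat measure"]
    by (simp add: sets_PiM_equal_borel PiE_UNIV_domain)
  have meas: "S \<inter> A \<in> sets M" if "A \<in> sets borel" for A
    using that M(2) by (auto simp: sets_restrict_space)
  have bC: "C \<in> sets borel" if "\<forall>x y. agree m x y \<longrightarrow> x \<in> C \<longrightarrow> y \<in> C" for m C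
    by (rule borel_open, rule open_if_agree_closed[of m]) (use that in blast)
  have "B \<in> sigma_sets UNIV ?G" using B sigma by simp
  then show ?thesis using e
  proof (induction arbitrary: e rule: sigma_sets.induct)
    case (Basic a)
    then obtain i A where a: "a = {f. f i \<in> A}" by auto
    have "\<forall>x y. agree (nat \<bar>i\<bar>) x y \<longrightarrow> x \<in> a \<longrightarrow> y \<in> a"
    proof (intro allI impI)
      fix x y :: "int \<Rightarrow> nat" assume "agree (nat \<bar>i\<bar>) x y" "x \<in> a"
      moreover have "i \<in> {- int (nat \<bar>i\<bar>)..int (nat \<bar>i\<bar>)}" by auto
      ultimately show "y \<in> a" unfolding agree_def a by (metis mem_Collect_eq)
    qed
    then show ?case using Basic.prems by (intro exI[of _ "nat \<bar>i\<bar>"] exI[of _ a]) simp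
  next
    case Empty
    then show ?case by (intro exI[of _ 0] exI[of _ "{}"]) simp
  next
    case (Compl a)
    then obtain m C where mC: "\<forall>x y. agree m x y \<longrightarrow> x \<in> C \<longrightarrow> y \<in> C"
      "measure M (S \<inter> sym_diff a C) < e" by blast
    have "S \<inter> sym_diff (UNIV - a) (- C) = S \<inter> sym_diff a C" by blast
    moreover have "\<forall>x y. agree m x y \<longrightarrow> x \<in> - C \<longrightarrow> y \<in> - C"
      using mC(1) agree_sym by blast
    ultimately show ?case using mC(2) by metis
  next
    case (Union a)
    have ab: "a i \<in> sets borel" for i using Union.hyps sigma by blast
    define U where "U N = S \<inter> (\<Union>i<N. a i)" for N
    have UM: "U N \<in> sets M" for N unfolding U_def using ab by (intro meas) auto
    have "(\<lambda>N. measure M (U N)) \<longlonglongrightarrow> measure M (\<Union>N. U N)"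
    proof (intro finite_Lim_measure_incseq)
      show "incseq U" unfolding U_def incseq_def by (intro allI impI Int_mono UN_mono) auto
    qed (use UM in auto)
    moreover have UU: "(\<Union>N. U N) = S \<inter> (\<Union>i. a i)" by (auto simp: U_def)
    ultimately have "eventually (\<lambda>N. measure M (S \<inter> (\<Union>i. a i)) - e / 2 < measure M (U N)) sequentially"
      using \<open>e > 0\<close> by (intro order_tendstoD(1)) auto
    then obtain N where N: "measure M (S \<inter> (\<Union>i. a i)) - e / 2 < measure M (U N)"
      by (meson eventually_sequentially order_refl)
    \<comment> \<open>With error \<open>d\<close> each, the \<open>N\<close> approximations stay
      within \<open>e / 2\<close> in total; \<open>N + 1\<close> keeps the quotient meaningful for
      \<open>N = 0\<close>.\<close>
    define d where "d = e / (2 * (real N + 1))"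
    have "d > 0" using \<open>e > 0\<close> by (simp add: d_def)
    define Q where "Q i m C \<longleftrightarrow> (\<forall>x y. agree m x y \<longrightarrow> x \<in> C \<longrightarrow> y \<in> C) \<and>
        measure M (S \<inter> sym_diff (a i) C) < d" for i m C
    have "\<exists>m C. Q i m C" for i unfolding Q_def by (rule Union.IH) fact
    then obtain m C where Q: "\<And>i. Q i (m i) (C i)" by metis
    have mC: "\<forall>x y. agree (m i) x y \<longrightarrow> x \<in> C i \<longrightarrow> y \<in> C i"
      "measure M (S \<inter> sym_diff (a i) (C i)) < d" for i
      using Q[of i] by (auto simp only: Q_def)
    define m' where "m' = Max (m ` {..<N} \<union> {0})"
    have mm: "m i \<le> m'" if "i < N" for i using that by (auto simp: m'_def)
    let ?C = "\<Union>i<N. C i"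
    have ag: "\<forall>x y. agree m' x y \<longrightarrow> x \<in> ?C \<longrightarrow> y \<in> ?C"
    proof (intro allI impI)
      fix x y assume xy: "agree m' x y" "x \<in> ?C"
      then obtain i where i: "i < N" "x \<in> C i" by blast
      then have "y \<in> C i" using mC(1)[of i] agree_mono[OF xy(1) mm[OF i(1)]] by simp
      then show "y \<in> ?C" using i(1) by blast
    qed
    have sm: "S \<inter> sym_diff (a i) (C i) \<in> sets M" for i
      using ab bC[OF mC(1)] by (intro meas) auto
    have aM: "S \<inter> (\<Union>i. a i) \<in> sets M"
      using ab by (intro meas sets.countable_UN) auto
    have dM: "(\<Union>i<N. S \<inter> sym_diff (a i) (C i)) \<in> sets M"
      using sm by (intro sets.finite_UN) auto
    have "measure M (S \<inter> sym_diff (\<Union>i. a i) ?C) \<le>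
        measure M ((S \<inter> (\<Union>i. a i) - U N) \<union> (\<Union>i<N. S \<inter> sym_diff (a i) (C i)))"
    proof (rule finite_measure_mono)
      show "(S \<inter> (\<Union>i. a i) - U N) \<union> (\<Union>i<N. S \<inter> sym_diff (a i) (C i)) \<in> sets M"
        by (intro sets.Un sets.Diff aM UM dM)
    qed (auto simp: U_def)
    also have "\<dots> \<le> measure M (S \<inter> (\<Union>i. a i) - U N) + measure M (\<Union>i<N. S \<inter> sym_diff (a i) (C i))"
      by (intro measure_Un_le sets.Diff aM UM dM)
    also have "measure M (S \<inter> (\<Union>i. a i) - U N) = measure M (S \<inter> (\<Union>i. a i)) - measure M (U N)"
      by (intro finite_measure_Diff aM UM) (auto simp: U_def)
    also have "measure M (\<Union>i<N. S \<inter> sym_diff (a i) (C i)) \<le> (\<Sum>i<N. measure M (S \<inter> sym_diff (a i) (C i)))"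
      using sm by (intro measure_UNION_le) auto
    also have "\<dots> \<le> (\<Sum>i<N. d)" using mC(2) by (intro sum_mono less_imp_le)
    also have "\<dots> \<le> e / 2" using \<open>e > 0\<close> by (simp add: d_def field_simps)
    finally have "measure M (S \<inter> sym_diff (\<Union>i. a i) ?C) < e" using N by linarith
    then show ?case using ag by blast
  qed
qed

text \<open>\<open>b\<close> guesses the cell of a point from the coordinates in
  \<open>{-m..m}\<close>. It is defined on all sequences, not just on \<open>S\<close>, because it
  is later evaluated on windows filled arbitrarily outside a finite set.\<close>

lemma partition_cylinder_approx:
  fixes M :: "(int \<Rightarrow> nat) measure"
  assumes M: "finite_measure M" "sets M = sets (restrict_space borel S)"
    and P: "finite P" "P \<noteq> {}" "P \<subseteq> sets M" "partition_on S P" and e: "e > 0"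
  shows "\<exists>m b. (\<forall>x. b x \<in> P) \<and> (\<forall>x y. agree m x y \<longrightarrow> b x = b y) \<and>
           {x\<in>S. x \<notin> b x} \<in> sets M \<and> measure M {x\<in>S. x \<notin> b x} < e"
proof -
  interpret finite_measure M by fact
  define d where "d = e / real (card P)"
  have cP: "card P > 0" using P by (simp add: card_gt_0_iff)
  then have "d > 0" using e by (simp add: d_def)
  have meas: "S \<inter> A \<in> sets M" if "A \<in> sets borel" for A
    using that M(2) by (auto simp: sets_restrict_space)
  have "\<exists>B m C. B \<in> sets borel \<and> p = S \<inter> B \<and> (\<forall>x y. agree m x y \<longrightarrow> x \<in> C \<longrightarrow> y \<in> C) \<and>
      measure M (S \<inter> sym_diff B C) < d" if "p \<in> P" for p
  proof -
    have "p \<in> (\<inter>) S ` sets borel"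
      using P(3) that M(2) by (auto simp: sets_restrict_space)
    then obtain B where "B \<in> sets borel" "p = S \<inter> B" by blast
    moreover obtain m C where "\<forall>x y. agree m x y \<longrightarrow> x \<in> C \<longrightarrow> y \<in> C"
      "measure M (S \<inter> sym_diff B C) < d"
      using cylinder_approx[OF M \<open>B \<in> sets borel\<close> \<open>d > 0\<close>] by blast
    ultimately show ?thesis by (intro exI[of _ B], intro exI[of _ m], intro exI[of _ C]) simp
  qed
  then obtain B m C where BmC: "\<And>p. p \<in> P \<Longrightarrow> B p \<in> sets borel" "\<And>p. p \<in> P \<Longrightarrow> p = S \<inter> B p"
    "\<And>p x y. p \<in> P \<Longrightarrow> agree (m p) x y \<Longrightarrow> x \<in> C p \<Longrightarrow> y \<in> C p"
    "\<And>p. p \<in> P \<Longrightarrow> measure M (S \<inter> sym_diff (B p) (C p)) < d" by metis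
  define m' where "m' = Max (m ` P)"
  have mm: "m p \<le> m'" if "p \<in> P" for p using that P by (simp add: m'_def)
  obtain p0 where p0: "p0 \<in> P" using P by blast
  \<comment> \<open>The cylinder sets \<open>C p\<close> need not be disjoint and need not cover
    everything. Hence the choice of any fitting cell, and the default \<open>p0\<close>.\<close>
  define b where "b x = (if \<exists>p\<in>P. x \<in> C p then (SOME p. p \<in> P \<and> x \<in> C p) else p0)" for x
  have bP: "b x \<in> P" for x
  proof (cases "\<exists>p\<in>P. x \<in> C p")
    case True
    then have "\<exists>p. p \<in> P \<and> x \<in> C p" by blast
    from someI_ex[OF this] show ?thesis using True by (simp add: b_def)
  qed (simp add: b_def p0)
  have bC: "x \<in> C (b x)" if "\<exists>p\<in>P. x \<in> C p" for x
  proof -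
    have "\<exists>p. p \<in> P \<and> x \<in> C p" using that by blast
    from someI_ex[OF this] show ?thesis using that by (simp add: b_def)
  qed
  have ba: "b x = b y" if "agree m' x y" for x y
  proof -
    have "x \<in> C p \<longleftrightarrow> y \<in> C p" if "p \<in> P" for p
      using BmC(3)[OF that] agree_mono[OF \<open>agree m' x y\<close> mm[OF that]] agree_sym by blast
    then have "(\<lambda>p. p \<in> P \<and> x \<in> C p) = (\<lambda>p. p \<in> P \<and> y \<in> C p)" "(\<exists>p\<in>P. x \<in> C p) = (\<exists>p\<in>P. y \<in> C p)"
      by auto
    then show ?thesis unfolding b_def by simp
  qed
  have Deq: "{x\<in>S. x \<notin> b x} = (\<Union>p\<in>P. (S \<inter> {x. b x = p}) - p)"
    using bP by auto
  have D: "{x\<in>S. x \<notin> b x} \<in> sets M"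
  proof -
    have "open {x. b x = p}" for p
      by (rule open_if_agree_closed[of m']) (use ba in auto)
    then have "S \<inter> {x. b x = p} \<in> sets M" for p by (intro meas) auto
    then show ?thesis unfolding Deq using P by (intro sets.finite_UN sets.Diff) auto
  qed
  have sm: "S \<inter> sym_diff (B p) (C p) \<in> sets M" if "p \<in> P" for p
  proof -
    have "open (C p)" using open_if_agree_closed[of "m p" "C p"] BmC(3)[OF that] by blast
    then show ?thesis using BmC(1)[OF that] by (intro meas) auto
  qed
  have "measure M {x\<in>S. x \<notin> b x} \<le> measure M (\<Union>p\<in>P. S \<inter> sym_diff (B p) (C p))"
  proof (rule finite_measure_mono)
    show "{x\<in>S. x \<notin> b x} \<subseteq> (\<Union>p\<in>P. S \<inter> sym_diff (B p) (C p))"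
    proof
      fix x assume x: "x \<in> {x\<in>S. x \<notin> b x}"
      show "x \<in> (\<Union>p\<in>P. S \<inter> sym_diff (B p) (C p))"
      proof (rule ccontr)
        assume "\<not> ?thesis"
        \<comment> \<open>Outside all the symmetric differences, \<open>B p\<close> and
          \<open>C p\<close> cannot be told apart at \<open>x\<close>. So the true cell makes some
          \<open>C p\<close> contain \<open>x\<close>, and the cell chosen by \<open>b\<close>
          contains \<open>x\<close> in turn.\<close>
        then have iff: "x \<in> B p \<longleftrightarrow> x \<in> C p" if "p \<in> P" for p using x that by blast
        obtain p where p: "p \<in> P" "x \<in> p" using P(4) x by (auto simp: partition_on_def)
        then have "x \<in> C p" using BmC(2)[OF p(1)] iff[OF p(1)] by blast
        then have "x \<in> C (b x)" using bC p by blast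
        then have "x \<in> S \<inter> B (b x)" using iff[OF bP] x by blast
        then show False using BmC(2)[OF bP[of x]] x by blast
      qed
    qed
    show "(\<Union>p\<in>P. S \<inter> sym_diff (B p) (C p)) \<in> sets M"
      using sm P by (intro sets.finite_UN) auto
  qed
  also have "\<dots> \<le> (\<Sum>p\<in>P. measure M (S \<inter> sym_diff (B p) (C p)))"
    using sm P by (intro measure_UNION_le) auto
  also have "\<dots> < (\<Sum>p\<in>P. d)"
    using BmC(4) P by (intro sum_strict_mono) auto
  also have "\<dots> = e" using cP by (simp add: d_def)
  finally show ?thesis using bP ba D by blast
qed

text \<open>Gibbs' inequality, from \<open>ln t \<le> t - 1\<close> at \<open>t = q i / p i\<close>.
  Neither family has to sum to 1; it is enough that \<open>q\<close> has no more mass than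
  \<open>p\<close>.\<close>

lemma entropy_le_cross_entropy:
  fixes p q :: "'i \<Rightarrow> real"
  assumes "\<And>i. i \<in> I \<Longrightarrow> p i \<ge> 0" "\<And>i. i \<in> I \<Longrightarrow> q i > 0" "sum q I \<le> sum p I"
  shows "- (\<Sum>i\<in>I. p i * ln (p i)) \<le> (\<Sum>i\<in>I. p i * - ln (q i))"
proof -
  have "p i * - ln (p i) \<le> p i * - ln (q i) + q i - p i" if i: "i \<in> I" for i
  proof (cases "p i = 0")
    case False
    then have "p i > 0" "q i > 0" using assms i by (auto simp: less_le)
    then have "p i * ln (q i / p i) \<le> p i * (q i / p i - 1)"
      by (intro mult_left_mono ln_le_minus_one) auto
    then show ?thesis using \<open>p i > 0\<close> \<open>q i > 0\<close> by (simp add: ln_div algebra_simps)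
  qed (use assms i in \<open>auto simp: less_imp_le\<close>)
  then have "(\<Sum>i\<in>I. p i * - ln (p i)) \<le> (\<Sum>i\<in>I. p i * - ln (q i) + q i - p i)"
    by (rule sum_mono)
  then show ?thesis using assms(3) by (simp add: sum.distrib sum_subtractf sum_negf)
qed

section \<open>Names of points and the entropy of joins\<close>

definition name_cell :: "'a set \<Rightarrow> ('a \<Rightarrow> 'a) \<Rightarrow> nat \<Rightarrow> (nat \<Rightarrow> 'a set) \<Rightarrow> 'a set" where
  "name_cell S T n w = {x \<in> S. \<forall>k<n. (T ^^ k) x \<in> w k}"

lemma iterated_join_eq: "iterated_join S T P n = name_cell S T n ` (PiE {..<n} (\<lambda>_. P))"
proof
  show "iterated_join S T P n \<subseteq> name_cell S T n ` (PiE {..<n} (\<lambda>_. P))"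
  proof
    fix c assume "c \<in> iterated_join S T P n"
    then obtain u where u: "c = {x \<in> S. \<forall>k<n. (T ^^ k) x \<in> u k}" "\<forall>k<n. u k \<in> P"
      by (auto simp: iterated_join_def)
    have "c = name_cell S T n (restrict u {..<n})" by (auto simp: u name_cell_def)
    moreover have "restrict u {..<n} \<in> PiE {..<n} (\<lambda>_. P)" using u by auto
    ultimately show "c \<in> name_cell S T n ` (PiE {..<n} (\<lambda>_. P))" by blast
  qed
  show "name_cell S T n ` (PiE {..<n} (\<lambda>_. P)) \<subseteq> iterated_join S T P n"
  proof (rule image_subsetI)
    fix w assume "w \<in> PiE {..<n} (\<lambda>_. P)"
    then have "\<forall>k<n. w k \<in> P" by auto
    then show "name_cell S T n w \<in> iterated_join S T P n"
      unfolding iterated_join_def name_cell_def by blast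
  qed
qed

lemma name_cell_unique:
  assumes P: "partition_on S P" and w: "w \<in> PiE {..<n} (\<lambda>_. P)" "w' \<in> PiE {..<n} (\<lambda>_. P)"
    and x: "x \<in> name_cell S T n w" "x \<in> name_cell S T n w'"
  shows "w = w'"
proof (rule PiE_ext[OF w])
  fix k assume k: "k \<in> {..<n}"
  then have "w k \<in> P" "w' k \<in> P" "(T ^^ k) x \<in> w k \<inter> w' k"
    using w x by (auto simp: name_cell_def)
  then show "w k = w' k"
    using P unfolding partition_on_def disjoint_def by blast
qed

lemma name_cell_exists:
  assumes P: "partition_on S P" and T: "T \<in> S \<rightarrow> S" and x: "x \<in> S"
  shows "\<exists>w\<in>PiE {..<n} (\<lambda>_. P). x \<in> name_cell S T n w"
proof -
  have "(T ^^ k) x \<in> S" for k using T x by (induction k) auto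
  then have "\<forall>k. \<exists>p\<in>P. (T ^^ k) x \<in> p" using P by (auto simp: partition_on_def)
  then obtain f where f: "\<And>k. f k \<in> P" "\<And>k. (T ^^ k) x \<in> f k" by metis
  have "restrict f {..<n} \<in> PiE {..<n} (\<lambda>_. P)" using f by auto
  moreover have "x \<in> name_cell S T n (restrict f {..<n})"
    using f x by (auto simp: name_cell_def)
  ultimately show ?thesis by blast
qed

text \<open>The join is a set of cells, while the sum on the right runs over names. Distinct names
  can share a cell only if it is empty, and an empty cell contributes 0.\<close>

lemma partition_entropy_join:
  assumes P: "finite P" "partition_on S P"
  shows "partition_entropy M (iterated_join S T P n) =
    - (\<Sum>w\<in>PiE {..<n} (\<lambda>_. P). measure M (name_cell S T n w) * ln (measure M (name_cell S T n w)))"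
proof -
  let ?W = "PiE {..<n} (\<lambda>_. P)" and ?g = "\<lambda>A. measure M A * ln (measure M A)"
  have "sum ?g (name_cell S T n ` ?W) = sum (?g \<circ> name_cell S T n) ?W"
  proof (rule sum.reindex_nontrivial)
    show "finite ?W" using P by (intro finite_PiE) auto
    fix w w' assume w: "w \<in> ?W" "w' \<in> ?W" "w \<noteq> w'" "name_cell S T n w = name_cell S T n w'"
    then have "name_cell S T n w = {}" using name_cell_unique[OF P(2) w(1,2)] by blast
    then show "?g (name_cell S T n w) = 0" by simp
  qed
  then show ?thesis unfolding partition_entropy_def iterated_join_eq by simp
qed

lemma invariant_measure_funpow:
  assumes "invariant_measure M T"
  shows "T ^^ n \<in> measurable M M" "distr M M (T ^^ n) = M"
proof -
  have T: "T \<in> measurable M M" "distr M M T = M" using assms by (auto simp: invariant_measure_def)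
  show m: "T ^^ n \<in> measurable M M" for n
    by (induction n) (auto intro!: measurable_compose[OF _ T(1)] simp: comp_def id_def)
  show "distr M M (T ^^ n) = M"
    using T m
  proof (induction n)
    case (Suc n)
    have "distr M M (T ^^ Suc n) = distr (distr M M (T ^^ n)) M T"
      using distr_distr[OF T(1) m] by simp
    then show ?case using Suc T by (simp only: funpow.simps)
  qed (simp add: id_def distr_id)
qed

lemma invariant_measure_vimage:
  assumes "invariant_measure M T" "A \<in> sets M"
  shows "measure M ((T ^^ n) -` A \<inter> space M) = measure M A"
  using measure_distr[OF invariant_measure_funpow(1)[OF assms(1)] assms(2), of n]
    invariant_measure_funpow(2)[OF assms(1), of n] by simp

lemma name_cell_measurable:
  assumes "invariant_measure M T" "P \<subseteq> sets M" "w \<in> PiE {..<n} (\<lambda>_. P)"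
  shows "name_cell (space M) T n w \<in> sets M"
proof -
  have pre: "(T ^^ k) -` w k \<inter> space M \<in> sets M" if "k < n" for k
    using invariant_measure_funpow(1)[OF assms(1)] assms that
    by (intro measurable_sets) (auto dest!: PiE_mem)
  show ?thesis
  proof (cases "n = 0")
    case False
    have "name_cell (space M) T n w = (\<Inter>k\<in>{..<n}. (T ^^ k) -` w k \<inter> space M)"
      using False by (auto simp: name_cell_def)
    moreover have "\<dots> \<in> sets M" by (intro sets.finite_INT pre) (use False in auto)
    ultimately show ?thesis by simp
  qed (simp add: name_cell_def)
qed

lemma sum_measure_name_cell:
  assumes "prob_space M" and inv: "invariant_measure M T"
    and P: "finite P" "P \<subseteq> sets M" "partition_on (space M) P"
  shows "(\<Sum>w\<in>PiE {..<n} (\<lambda>_. P). measure M (name_cell (space M) T n w)) = 1"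
proof -
  interpret prob_space M by fact
  let ?W = "PiE {..<n} (\<lambda>_. P)" and ?cell = "name_cell (space M) T n"
  have "(\<Sum>w\<in>?W. measure M (?cell w)) = measure M (\<Union>w\<in>?W. ?cell w)"
  proof (rule finite_measure_finite_Union[symmetric])
    show "finite ?W" using P by (intro finite_PiE) auto
    show "?cell ` ?W \<subseteq> sets M" using name_cell_measurable[OF inv P(2)] by blast
    show "disjoint_family_on ?cell ?W"
      using name_cell_unique[OF P(3)] unfolding disjoint_family_on_def by blast
  qed
  also have "(\<Union>w\<in>?W. ?cell w) = space M"
  proof -
    have "T \<in> space M \<rightarrow> space M" using inv by (auto simp: invariant_measure_def measurable_def)
    from name_cell_exists[OF P(3) this] show ?thesis by (auto simp: name_cell_def)
  qed
  finally show ?thesis by (simp add: prob_space)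
qed

section \<open>Entropy of a join bounded by a random window with noise\<close>

lemma sum_smoothed_mass_le:
  fixes \<delta> :: real
  assumes P: "finite P" "P \<noteq> {}" and \<delta>: "0 < \<delta>" "\<delta> < 1"
  shows "(\<Sum>p\<in>P. (if p = c then 1 - \<delta> else 0) + \<delta> / real (card P)) \<le> 1"
proof -
  have "card P > 0" using P by (simp add: card_gt_0_iff)
  then show ?thesis
    using P \<delta> by (simp add: sum.distrib sum.delta)
qed

text \<open>The cross entropy is taken against the law of the names of a uniformly random window over
  \<open>A\<close>, where a name is read off through the cylinder approximation \<open>b\<close> of the partition and
  smoothed by noise of size \<open>\<delta>\<close>.\<close>

lemma partition_entropy_join_le:
  fixes M :: "(int \<Rightarrow> nat) measure"
  assumes "prob_space M" and inv: "invariant_measure M left_shift"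
    and A: "finite A" "AE x in M. \<forall>i. x i \<in> A"
    and P: "finite P" "P \<noteq> {}" "P \<subseteq> sets M" "partition_on (space M) P"
    and b: "\<And>x. b x \<in> P" "\<And>x y. agree m x y \<Longrightarrow> b x = b y"
    and D: "{x\<in>space M. x \<notin> b x} \<in> sets M"
    and \<delta>: "0 < \<delta>" "\<delta> < 1"
  shows "partition_entropy M (iterated_join (space M) left_shift P n) \<le>
     real (n + 2 * m) * ln (real (card A)) +
     real n * (- ln (1 - \<delta>) + ln (real (card P) / \<delta>) * measure M {x\<in>space M. x \<notin> b x})"
proof -
  interpret prob_space M by fact
  let ?T = left_shift and ?S = "space M" and ?D = "{x\<in>space M. x \<notin> b x}"
  let ?W = "PiE {..<n} (\<lambda>_. P)" and ?cell = "name_cell (space M) left_shift n"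
  \<comment> \<open>The coordinates that determine the guesses \<open>b\<close> at the times
    \<open>0..<n\<close>: a margin of \<open>m\<close> on either side, \<open>n + 2 * m\<close>
    positions in all.\<close>
  define J where "J = {- int m..<int n + int m}"
  define V where "V = PiE J (\<lambda>_. A)"
  \<comment> \<open>The noisy channel: keep the guessed cell \<open>c\<close> with probability
    \<open>1 - \<delta>\<close>, otherwise draw a uniform cell. The noise keeps \<open>q\<close>
    positive on every name, so that its logarithm is under control even where the guess is
    wrong.\<close>
  define \<rho> where "\<rho> p c = (if p = c then 1 - \<delta> else 0) + \<delta> / real (card P)" for p c :: "(int \<Rightarrow> nat) set"
  define q where "q w = (\<Sum>v\<in>V. \<Prod>t<n. \<rho> (w t) (b ((?T ^^ t) v))) / real (card V)" for w
  define c0 where "c0 = - ln (1 - \<delta>)"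
  define c1 where "c1 = ln (real (card P) / \<delta>)"
  \<comment> \<open>A bound for \<open>- ln (q w)\<close> at points with name \<open>w\<close>: the
    logarithm of the number of windows, \<open>c0\<close> at every time, and in addition
    \<open>c1\<close> at each time when the guess fails.\<close>
  define R where "R x = ln (real (card V)) + (\<Sum>t<n. c0 + c1 * indicator ((?T ^^ t) -` ?D \<inter> ?S) x)" for x
  have cP: "card P \<ge> 1" using P by (simp add: Suc_le_eq card_gt_0_iff)
  have "A \<noteq> {}"
  proof
    assume "A = {}"
    then have "AE x in M. False" using A(2) by simp
    then show False by simp
  qed
  then have cA: "card A > 0" using A by (simp add: card_gt_0_iff)
  have fJ: "finite J" and cJ: "card J = n + 2 * m" by (auto simp: J_def)
  have fV: "finite V" unfolding V_def using fJ A by (intro finite_PiE) auto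
  have cV: "card V = card A ^ (n + 2 * m)"
    unfolding V_def using fJ by (simp add: card_PiE cJ)
  then have cV0: "card V > 0" using cA by simp
  have fW: "finite ?W" using P by (intro finite_PiE) auto
  have \<rho>pos: "\<rho> p c > 0" for p c using cP \<delta> by (auto simp: \<rho>_def intro!: add_nonneg_pos)
  have qpos: "q w > 0" for w
  proof -
    have "V \<noteq> {}" using cV0 by auto
    then have "(\<Sum>v\<in>V. \<Prod>t<n. \<rho> (w t) (b ((?T ^^ t) v))) > 0"
      using fV \<rho>pos by (intro sum_pos prod_pos) auto
    then show ?thesis using cV0 by (simp add: q_def)
  qed
  have sumq: "(\<Sum>w\<in>?W. q w) \<le> 1"
  proof -
    have "(\<Sum>w\<in>?W. q w) = (\<Sum>w\<in>?W. \<Sum>v\<in>V. \<Prod>t<n. \<rho> (w t) (b ((?T ^^ t) v))) / real (card V)"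
      by (simp add: q_def sum_divide_distrib)
    also have "(\<Sum>w\<in>?W. \<Sum>v\<in>V. \<Prod>t<n. \<rho> (w t) (b ((?T ^^ t) v))) =
        (\<Sum>v\<in>V. \<Sum>w\<in>?W. \<Prod>t<n. \<rho> (w t) (b ((?T ^^ t) v)))"
      by (rule sum.swap)
    \<comment> \<open>For a fixed window the noise acts independently at each time, so the sum over
      names factorises into one factor of at most 1 per time.\<close>
    also have "\<dots> = (\<Sum>v\<in>V. \<Prod>t<n. \<Sum>p\<in>P. \<rho> p (b ((?T ^^ t) v)))"
      using P by (subst prod_sum_PiE) auto
    also have "\<dots> \<le> (\<Sum>v\<in>V. 1)"
    proof (intro sum_mono prod_le_1 conjI)
      show "0 \<le> (\<Sum>p\<in>P. \<rho> p c)" for c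
        using \<rho>pos by (intro sum_nonneg) (auto intro: less_imp_le)
      show "(\<Sum>p\<in>P. \<rho> p c) \<le> 1" for c
        unfolding \<rho>_def by (rule sum_smoothed_mass_le[OF P(1,2) \<delta>])
    qed
    finally show ?thesis using cV0 by (simp add: divide_right_mono)
  qed
  have TS: "?T \<in> ?S \<rightarrow> ?S" using inv by (auto simp: invariant_measure_def measurable_def)
  have cell_sets: "?cell w \<in> sets M" if "w \<in> ?W" for w
    by (rule name_cell_measurable[OF inv P(3) that])
  \<comment> \<open>The cells of different names are disjoint, so only the name of \<open>x\<close>
    survives in the sum.\<close>
  have total: "(\<Sum>w\<in>?W. indicator (?cell w) x * f w) = (f w0 :: real)"
    if "w0 \<in> ?W" "x \<in> ?cell w0" for x w0 f
  proof -
    have "(\<Sum>w\<in>?W. indicator (?cell w) x * f w) = (\<Sum>w\<in>?W. if w = w0 then f w else 0)"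
    proof (rule sum.cong)
      fix w assume w: "w \<in> ?W"
      have "x \<notin> ?cell w" if "w \<noteq> w0"
        using name_cell_unique[OF P(4) w \<open>w0 \<in> ?W\<close> _ \<open>x \<in> ?cell w0\<close>] that by blast
      then show "indicator (?cell w) x * f w = (if w = w0 then f w else 0)"
        using that by simp
    qed simp
    then show ?thesis using fW that by (simp add: sum.delta)
  qed
  have pointwise: "- ln (q w) \<le> R x" if w: "w \<in> ?W" and x: "x \<in> ?cell w" and xA: "\<forall>i. x i \<in> A" for w x
  proof -
    \<comment> \<open>One of the averaged windows is the one seen by \<open>x\<close>. Keeping only
      its term bounds \<open>q w\<close> from below and costs \<open>ln (card V)\<close>. Outside
      \<open>J\<close> this window is junk, but \<open>b\<close> does not look there.\<close>
    let ?v = "restrict x J"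
    have v: "?v \<in> V" using xA by (auto simp: V_def)
    have bv: "b ((?T ^^ t) ?v) = b ((?T ^^ t) x)" if "t < n" for t
      using that by (intro b(2)) (auto simp: agree_def left_shift_funpow J_def)
    have prodpos: "(\<Prod>t<n. \<rho> (w t) (b ((?T ^^ t) x))) > 0" using \<rho>pos by (intro prod_pos) auto
    have "(\<Prod>t<n. \<rho> (w t) (b ((?T ^^ t) x))) = (\<Prod>t<n. \<rho> (w t) (b ((?T ^^ t) ?v)))"
      using bv by (intro prod.cong) auto
    also have "\<dots> \<le> (\<Sum>v\<in>V. \<Prod>t<n. \<rho> (w t) (b ((?T ^^ t) v)))"
      using fV \<rho>pos by (intro member_le_sum[OF v] prod_nonneg) (auto intro: less_imp_le)
    also have "\<dots> = q w * real (card V)" using cV0 by (simp add: q_def)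
    finally have "ln (\<Prod>t<n. \<rho> (w t) (b ((?T ^^ t) x))) \<le> ln (q w * real (card V))"
      using prodpos qpos[of w] cV0 by simp
    also have "\<dots> = ln (q w) + ln (real (card V))"
      using qpos[of w] cV0 by (simp add: ln_mult)
    also have "ln (\<Prod>t<n. \<rho> (w t) (b ((?T ^^ t) x))) = (\<Sum>t<n. ln (\<rho> (w t) (b ((?T ^^ t) x))))"
      using \<rho>pos[THEN less_imp_neq, symmetric] by (intro ln_prod) auto
    finally have "- ln (q w) \<le> ln (real (card V)) + (\<Sum>t<n. - ln (\<rho> (w t) (b ((?T ^^ t) x))))"
      by (simp add: sum_negf)
    also have "(\<Sum>t<n. - ln (\<rho> (w t) (b ((?T ^^ t) x)))) \<le>
        (\<Sum>t<n. c0 + c1 * indicator ((?T ^^ t) -` ?D \<inter> ?S) x)"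
    proof (rule sum_mono)
      fix t assume "t \<in> {..<n}"
      then have tn: "t < n" by simp
      have xS: "x \<in> ?S" using x by (simp add: name_cell_def)
      have TxS: "(?T ^^ t) x \<in> ?S" using TS xS by (induction t) auto
      have wt: "w t \<in> P" "(?T ^^ t) x \<in> w t"
        using w x tn by (auto simp: name_cell_def)
      have c0: "c0 \<ge> 0" using \<delta> by (simp add: c0_def)
      show "- ln (\<rho> (w t) (b ((?T ^^ t) x))) \<le> c0 + c1 * indicator ((?T ^^ t) -` ?D \<inter> ?S) x"
      proof (cases "(?T ^^ t) x \<in> ?D")
        case True
        have "\<delta> / real (card P) \<le> \<rho> (w t) (b ((?T ^^ t) x))" using \<delta> by (simp add: \<rho>_def)
        then have "ln (\<delta> / real (card P)) \<le> ln (\<rho> (w t) (b ((?T ^^ t) x)))"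
          using \<delta> cP by (intro iffD2[OF ln_le_cancel_iff]) (auto intro: \<rho>pos)
        moreover have "ln (\<delta> / real (card P)) = - c1" using \<delta> cP by (simp add: c1_def ln_div)
        ultimately show ?thesis using c0 True xS by (simp add: indicator_def)
      next
        case False
        then have "(?T ^^ t) x \<in> b ((?T ^^ t) x)" using TxS by simp
        then have "w t = b ((?T ^^ t) x)"
          using wt b(1)[of "(?T ^^ t) x"] P(4) unfolding partition_on_def disjoint_def by blast
        then have "1 - \<delta> \<le> \<rho> (w t) (b ((?T ^^ t) x))" using \<delta> by (simp add: \<rho>_def)
        then have "ln (1 - \<delta>) \<le> ln (\<rho> (w t) (b ((?T ^^ t) x)))"
          using \<delta> by (intro iffD2[OF ln_le_cancel_iff]) (auto intro: \<rho>pos)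
        moreover have "indicator ((?T ^^ t) -` ?D \<inter> ?S) x = (0 :: real)"
          using False by (simp add: indicator_def)
        ultimately show ?thesis by (simp add: c0_def)
      qed
    qed
    finally show ?thesis by (simp add: R_def)
  qed
  have Dt: "(?T ^^ t) -` ?D \<inter> ?S \<in> sets M" for t
    using invariant_measure_funpow(1)[OF inv] D by (rule measurable_sets)
  have int_ind: "integrable M (indicator B :: _ \<Rightarrow> real)" if "B \<in> sets M" for B
    using that by (intro integrable_real_indicator) (auto simp: emeasure_eq_measure)
  have int_term: "integrable M (\<lambda>x. c0 + c1 * indicator ((?T ^^ t) -` ?D \<inter> ?S) x)" for t
    using int_ind[OF Dt]
    by (intro Bochner_Integration.integrable_add integrable_const integrable_mult_right)
  have int_sum: "integrable M (\<lambda>x. \<Sum>t<n. c0 + c1 * indicator ((?T ^^ t) -` ?D \<inter> ?S) x)"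
    using int_term by (rule Bochner_Integration.integrable_sum)
  have intR: "integrable M R"
    unfolding R_def using int_sum by (intro Bochner_Integration.integrable_add integrable_const)
  have int_cell: "integrable M (\<lambda>x. indicator (?cell w) x * - ln (q w))" if "w \<in> ?W" for w
    using int_ind[OF cell_sets[OF that]] by (rule integrable_mult_left)
  have "partition_entropy M (iterated_join ?S ?T P n) =
      - (\<Sum>w\<in>?W. measure M (?cell w) * ln (measure M (?cell w)))"
    by (rule partition_entropy_join[OF P(1,4)])
  also have "\<dots> \<le> (\<Sum>w\<in>?W. measure M (?cell w) * - ln (q w))"
  proof (rule entropy_le_cross_entropy)
    show "(\<Sum>w\<in>?W. q w) \<le> (\<Sum>w\<in>?W. measure M (?cell w))"
      using sumq by (simp add: sum_measure_name_cell[OF \<open>prob_space M\<close> inv P(1,3,4)])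
  qed (use qpos in auto)
  also have "\<dots> = (\<integral>x. (\<Sum>w\<in>?W. indicator (?cell w) x * - ln (q w)) \<partial>M)"
  proof -
    have "(\<integral>x. indicator (?cell w) x * - ln (q w) \<partial>M) = measure M (?cell w) * - ln (q w)"
      if "w \<in> ?W" for w
      using int_ind[OF cell_sets[OF that]] cell_sets[OF that] by simp
    moreover have "(\<integral>x. (\<Sum>w\<in>?W. indicator (?cell w) x * - ln (q w)) \<partial>M) =
        (\<Sum>w\<in>?W. \<integral>x. indicator (?cell w) x * - ln (q w) \<partial>M)"
      by (rule Bochner_Integration.integral_sum) (rule int_cell)
    ultimately show ?thesis by (simp only: cong: sum.cong)
  qed
  also have "\<dots> \<le> (\<integral>x. R x \<partial>M)"
  proof (rule integral_mono_AE)
    show "integrable M (\<lambda>x. \<Sum>w\<in>?W. indicator (?cell w) x * - ln (q w))"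
      using int_cell by (rule Bochner_Integration.integrable_sum)
    show "AE x in M. (\<Sum>w\<in>?W. indicator (?cell w) x * - ln (q w)) \<le> R x"
      using A(2) AE_space
    proof eventually_elim
      case (elim x)
      obtain w0 where w0: "w0 \<in> ?W" "x \<in> ?cell w0"
        using name_cell_exists[OF P(4) TS elim(2)] by blast
      show ?case unfolding total[OF w0] by (rule pointwise[OF w0 elim(1)])
    qed
  qed (rule intR)
  also have "\<dots> = ln (real (card V)) + (\<Sum>t<n. c0 + c1 * measure M ?D)"
  proof -
    have "(\<integral>x. c0 + c1 * indicator ((?T ^^ t) -` ?D \<inter> ?S) x \<partial>M) =
        c0 + c1 * measure M ((?T ^^ t) -` ?D \<inter> ?S)" for t
      using int_ind[OF Dt, of t] Dt[of t]
      by (subst Bochner_Integration.integral_add) (auto simp: prob_space)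
    then have "(\<integral>x. R x \<partial>M) = ln (real (card V)) +
        (\<Sum>t<n. c0 + c1 * measure M ((?T ^^ t) -` ?D \<inter> ?S))"
      unfolding R_def using int_sum int_term
      by (subst Bochner_Integration.integral_add)
         (auto simp: prob_space Bochner_Integration.integral_sum)
    \<comment> \<open>Invariance: a wrong guess is equally likely at every time.\<close>
    then show ?thesis by (simp only: invariant_measure_vimage[OF inv D])
  qed
  also have "\<dots> = real (n + 2 * m) * ln (real (card A)) + real n * (c0 + c1 * measure M ?D)"
    using cA by (simp add: cV ln_realpow)
  finally show ?thesis by (simp add: c0_def c1_def)
qed

text \<open>This is needed for every finite measurable partition, hence the detour through guesses.
  For a fixed partition and error, the window margin \<open>m\<close> stays fixed while
  \<open>n\<close> grows, so its share \<open>2 * m * ln (card A) / n\<close> vanishes; noise and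
  wrong guesses contribute at most \<eta> per step.\<close>

lemma metric_entropy_le_ln_card:
  fixes M :: "(int \<Rightarrow> nat) measure"
  assumes M: "prob_space M" "sets M = sets (restrict_space borel S)"
    and inv: "invariant_measure M left_shift"
    and A: "finite A" "AE x in M. \<forall>i. x i \<in> A"
  shows "metric_entropy M left_shift \<le> ereal (ln (real (card A)))"
  unfolding metric_entropy_def
proof (rule SUP_least, clarify)
  fix P assume P: "finite P" "P \<subseteq> sets M" "partition_on (space M) P"
  interpret prob_space M by fact
  have space: "space M = S" using sets_eq_imp_space_eq[OF M(2)] by (simp add: space_restrict_space)
  have "P \<noteq> {}" using P(3) not_empty by (auto simp: partition_on_def)
  then have cP: "real (card P) \<ge> 1" using P by (simp add: Suc_le_eq card_gt_0_iff)
  show "metric_entropy_partition M left_shift P \<le> ereal (ln (real (card A)))"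
  proof (rule ereal_le_epsilon2)
    fix \<eta> :: real assume \<eta>: "\<eta> > 0"
    \<comment> \<open>Chosen so that \<open>- ln (1 - \<delta>) = \<eta> / 2\<close>, which is the
      price of the noise at each time.\<close>
    define \<delta> where "\<delta> = 1 - exp (- \<eta> / 2)"
    have \<delta>: "0 < \<delta>" "\<delta> < 1" using \<eta> by (auto simp: \<delta>_def)
    define c1 where "c1 = ln (real (card P) / \<delta>)"
    have c1: "c1 \<ge> 0" using cP \<delta> by (auto simp: c1_def)
    \<comment> \<open>Wrong guesses then cost at most \<open>c1 * e \<le> \<eta> / 2\<close>; adding
      1 keeps the denominator positive.\<close>
    define e where "e = \<eta> / (2 * (c1 + 1))"
    have "e > 0" using \<eta> c1 by (simp add: e_def)
    have "partition_on S P" using P(3) space by simp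
    from partition_cylinder_approx[OF finite_measure_axioms M(2) P(1) \<open>P \<noteq> {}\<close> P(2) this \<open>e > 0\<close>]
    obtain m b where b: "\<And>x. b x \<in> P" "\<And>x y. agree m x y \<Longrightarrow> b x = b y"
      "{x\<in>space M. x \<notin> b x} \<in> sets M" "measure M {x\<in>space M. x \<notin> b x} < e"
      unfolding space by blast
    have "c1 * measure M {x\<in>space M. x \<notin> b x} \<le> c1 * e"
      using c1 b(4) by (intro mult_left_mono) auto
    also have "\<dots> \<le> \<eta> / 2" using c1 \<eta> by (simp add: e_def field_simps)
    finally have le: "c1 * measure M {x\<in>space M. x \<notin> b x} \<le> \<eta> / 2" .
    let ?L = "ln (real (card A))"
    have bound: "partition_entropy M (iterated_join (space M) left_shift P n) / real n \<le>
        ?L + \<eta> + 2 * real m * ?L / real n" if "n > 0" for n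
    proof -
      have "partition_entropy M (iterated_join (space M) left_shift P n) \<le>
          real (n + 2 * m) * ?L + real n * (- ln (1 - \<delta>) + c1 * measure M {x\<in>space M. x \<notin> b x})"
        unfolding c1_def
        by (rule partition_entropy_join_le[OF M(1) inv A P(1) \<open>P \<noteq> {}\<close> P(2,3) b(1,2,3) \<delta>])
      also have "\<dots> \<le> real (n + 2 * m) * ?L + real n * \<eta>"
        using le by (intro add_left_mono mult_left_mono) (auto simp: \<delta>_def)
      finally show ?thesis using that by (simp add: field_simps)
    qed
    have "metric_entropy_partition M left_shift P \<le>
        limsup (\<lambda>n. ereal (?L + \<eta> + 2 * real m * ?L / real n))"
      unfolding metric_entropy_partition_def
      using bound by (intro Limsup_mono eventually_sequentiallyI[of 1]) auto
    also have "\<dots> = ereal (?L + \<eta> + 0)"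
    proof (rule lim_imp_Limsup)
      have "(\<lambda>n. 2 * real m * ?L / real n) \<longlonglongrightarrow> 0" by (rule lim_const_over_n)
      then show "(\<lambda>n. ereal (?L + \<eta> + 2 * real m * ?L / real n)) \<longlonglongrightarrow> ereal (?L + \<eta> + 0)"
        by (intro tendsto_ereal tendsto_add tendsto_const)
    qed simp
    finally show "metric_entropy_partition M left_shift P \<le> ereal ?L + ereal \<eta>" by simp
  qed
qed

section \<open>Bernoulli measures\<close>

text \<open>The uniform product measure, placed on the whole space of sequences so that product
  measure theory applies; it is restricted to the subshift afterwards.\<close>

definition bernoulli :: "nat set \<Rightarrow> (int \<Rightarrow> nat) measure" where
  "bernoulli A = PiM UNIV (\<lambda>_. measure_pmf (pmf_of_set A))"

lemma product_prob_space_bernoulli: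
  "product_prob_space (\<lambda>_. measure_pmf p)"
  by (simp add: product_prob_space_def product_sigma_finite_def product_prob_space_axioms_def
      measure_pmf.prob_space_axioms prob_space_imp_sigma_finite)

lemma sets_bernoulli: "sets (bernoulli A) = sets borel"
proof -
  have "sets (bernoulli A) = sets (PiM UNIV (\<lambda>_::int. borel :: nat measure))"
    unfolding bernoulli_def by (intro sets_PiM_cong) (auto simp: sets_borel_eq_count_space)
  then show ?thesis by (simp add: sets_PiM_equal_borel)
qed

lemma space_bernoulli: "space (bernoulli A) = UNIV"
  using sets_eq_imp_space_eq[OF sets_bernoulli] by simp

lemma prob_space_bernoulli: "prob_space (bernoulli A)"
  unfolding bernoulli_def by (intro prob_space_PiM measure_pmf.prob_space_axioms)

lemma AE_bernoulli:
  assumes "finite A" "A \<noteq> {}" shows "AE x in bernoulli A. \<forall>i. x i \<in> A"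
proof -
  interpret product_prob_space "\<lambda>_. measure_pmf (pmf_of_set A)" "UNIV :: int set"
    by (rule product_prob_space_bernoulli)
  have "AE a in measure_pmf (pmf_of_set A). a \<in> A"
    using assms by (auto simp: AE_measure_pmf_iff)
  then show ?thesis
    unfolding bernoulli_def AE_all_countable by (intro allI AE_component) auto
qed

text \<open>Only an inequality, because a symbol \<open>a k\<close> outside \<open>A\<close> has
  probability 0. The lower bound for the entropy needs nothing more.\<close>

lemma bernoulli_cylinder_le:
  assumes "finite A" "A \<noteq> {}"
  shows "measure (bernoulli A) {x. \<forall>k<n. x (int k) = a k} \<le> (1 / real (card A)) ^ n"
proof -
  interpret product_prob_space "\<lambda>_. measure_pmf (pmf_of_set A)" "UNIV :: int set"
    by (rule product_prob_space_bernoulli)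
  have cA: "card A > 0" using assms by (simp add: card_gt_0_iff)
  have "emeasure (bernoulli A) {x. \<forall>k<n. x (int k) = a k} =
      emeasure (bernoulli A) {x \<in> space (bernoulli A). \<forall>i\<in>int ` {..<n}. x i \<in> {a (nat i)}}"
    by (rule arg_cong[of _ _ "emeasure _"]) (auto simp: space_bernoulli)
  also have "\<dots> = (\<Prod>i\<in>int ` {..<n}. emeasure (measure_pmf (pmf_of_set A)) {a (nat i)})"
    unfolding bernoulli_def by (rule emeasure_PiM_Collect) auto
  also have "\<dots> = (\<Prod>k<n. ennreal (pmf (pmf_of_set A) (a k)))"
    by (subst prod.reindex) (auto simp: emeasure_pmf_single)
  also have "\<dots> = ennreal (\<Prod>k<n. pmf (pmf_of_set A) (a k))"
    by (intro prod_ennreal) auto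
  finally have "measure (bernoulli A) {x. \<forall>k<n. x (int k) = a k} = (\<Prod>k<n. pmf (pmf_of_set A) (a k))"
    by (simp add: measure_def prod_nonneg)
  also have "\<dots> \<le> (\<Prod>k<n. 1 / real (card A))"
    using assms cA by (intro prod_mono) (auto simp: indicator_def)
  finally show ?thesis by simp
qed

section \<open>Invariance, restriction to the subshift and exact entropy\<close>

lemma measurable_left_shift: "left_shift \<in> measurable (bernoulli A) (bernoulli A)"
  unfolding bernoulli_def
proof (rule measurable_PiM_single')
  show "(\<lambda>x. left_shift x i) \<in> measurable (PiM UNIV (\<lambda>_. measure_pmf (pmf_of_set A))) (measure_pmf (pmf_of_set A))" for i
    unfolding left_shift_def by (rule measurable_component_singleton) simp
qed (auto simp: space_PiM)

lemma distr_bernoulli: "distr (bernoulli A) (bernoulli A) left_shift = bernoulli A"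
  using distr_PiM_reindex[of UNIV "\<lambda>_. measure_pmf (pmf_of_set A)" "\<lambda>i::int. i + 1" UNIV]
  unfolding bernoulli_def left_shift_def
  by (simp add: measure_pmf.prob_space_axioms inj_on_def restrict_def)

lemma sets_restrict_bernoulli:
  "sets (restrict_space (bernoulli A) S) = sets (restrict_space borel S)"
  by (rule sets_restrict_space_cong[OF sets_bernoulli])

text \<open>The full shift over \<open>A\<close> carries all the mass and lies in \<open>S\<close>.
  Restriction to \<open>S\<close> therefore changes no measure, and invariance is inherited from the
  product measure.\<close>

lemma
  assumes A: "finite A" "A \<noteq> {}" and S: "S \<in> sets borel" "full_shift A \<subseteq> S" "left_shift ` S \<subseteq> S"
  shows prob_space_restrict_bernoulli: "prob_space (restrict_space (bernoulli A) S)"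
    and AE_restrict_bernoulli: "AE x in restrict_space (bernoulli A) S. \<forall>i. x i \<in> A"
    and invariant_restrict_bernoulli: "invariant_measure (restrict_space (bernoulli A) S) left_shift"
proof -
  let ?Q = "bernoulli A" and ?R = "restrict_space (bernoulli A) S"
  interpret prob_space ?Q by (rule prob_space_bernoulli)
  have SQ: "S \<in> sets ?Q" using S by (simp add: sets_bernoulli)
  have AES: "AE x in ?Q. x \<in> S"
    using AE_bernoulli[OF A] by eventually_elim (use S in \<open>auto simp: full_shift_def\<close>)
  show "prob_space ?R"
    using SQ emeasure_eq_1_AE[OF SQ AES] by (intro prob_space_restrict_space)
  show "AE x in ?R. \<forall>i. x i \<in> A"
    using SQ AE_bernoulli[OF A] by (subst AE_restrict_space_iff) (auto simp: space_bernoulli)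
  have TR: "left_shift \<in> measurable ?R ?R"
    using measurable_left_shift S by (intro measurable_restrict_space3) auto
  moreover have "distr ?R ?R left_shift = ?R"
  proof (rule measure_eqI)
    fix X assume X: "X \<in> sets (distr ?R ?R left_shift)"
    then have XS: "X \<subseteq> S" and XQ: "X \<in> sets ?Q"
      using SQ by (auto simp: sets_restrict_space_iff space_bernoulli)
    have pre: "left_shift -` X \<in> sets ?Q"
      using measurable_sets[OF measurable_left_shift XQ] by (simp add: space_bernoulli)
    have "emeasure (distr ?R ?R left_shift) X = emeasure ?R (left_shift -` X \<inter> S)"
      using emeasure_distr[OF TR, of X] X by (simp add: space_restrict_space space_bernoulli)
    also have "\<dots> = emeasure ?Q (left_shift -` X \<inter> S)"
      using SQ by (intro emeasure_restrict_space) (auto simp: space_bernoulli)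
    also have "\<dots> = emeasure ?Q (left_shift -` X)"
      using AES pre SQ by (intro emeasure_eq_AE) auto
    also have "\<dots> = emeasure (distr ?Q ?Q left_shift) X"
      using emeasure_distr[OF measurable_left_shift XQ] by (simp add: space_bernoulli)
    also have "\<dots> = emeasure ?R X"
      using XS SQ by (simp add: distr_bernoulli emeasure_restrict_space space_bernoulli)
    finally show "emeasure (distr ?R ?R left_shift) X = emeasure ?R X" .
  qed simp
  ultimately show "invariant_measure ?R left_shift" by (simp add: invariant_measure_def)
qed

text \<open>From above, the general bound applies. From below, the partition by the symbol at 0
  suffices: every cell of its \<open>n\<close>-fold join has mass at most
  \<open>(1 / card A) ^ n\<close>, so its information is at least
  \<open>n * ln (card A)\<close>.\<close>

lemma metric_entropy_restrict_bernoulli: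
  assumes A: "finite A" "A \<noteq> {}"
    and S: "S \<in> sets borel" "full_shift A \<subseteq> S" "left_shift ` S \<subseteq> S"
    and F: "finite F" "S \<subseteq> full_shift F"
  shows "metric_entropy (restrict_space (bernoulli A) S) left_shift = ereal (ln (real (card A)))"
proof (rule antisym)
  let ?M = "restrict_space (bernoulli A) S"
  note M = prob_space_restrict_bernoulli[OF A S] AE_restrict_bernoulli[OF A S]
    invariant_restrict_bernoulli[OF A S]
  show "metric_entropy ?M left_shift \<le> ereal (ln (real (card A)))"
    by (rule metric_entropy_le_ln_card[OF M(1) sets_restrict_bernoulli M(3) A(1) M(2)])
  have cA: "card A > 0" using A by (simp add: card_gt_0_iff)
  have SQ: "S \<in> sets (bernoulli A)" using S by (simp add: sets_bernoulli)
  have space: "space ?M = S" by (simp add: space_restrict_space space_bernoulli)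
  \<comment> \<open>Indexed only by the symbols that occur at 0 in \<open>S\<close>, since a
    partition must not contain the empty set.\<close>
  define P where "P = (\<lambda>a. {x\<in>S. x 0 = a}) ` ((\<lambda>x. x 0) ` S)"
  have "(\<lambda>x. x 0) ` S \<subseteq> F" using F by (auto simp: full_shift_def)
  then have fP: "finite P" unfolding P_def by (intro finite_imageI finite_subset[OF _ F(1)])
  have partP: "partition_on (space ?M) P"
    unfolding space partition_on_def
  proof (intro conjI)
    show "\<Union>P = S" by (auto simp: P_def)
    show "disjoint P"
    proof (rule disjointI)
      fix p q assume pq: "p \<in> P" "q \<in> P" "p \<noteq> q"
      obtain a where a: "p = {x\<in>S. x 0 = a}" using pq(1) unfolding P_def by (rule imageE)
      obtain b where b: "q = {x\<in>S. x 0 = b}" using pq(2) unfolding P_def by (rule imageE)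
      have "a \<noteq> b" using pq(3) a b by metis
      then show "p \<inter> q = {}" unfolding a b by blast
    qed
    show "{} \<notin> P" unfolding P_def by blast
  qed
  have PM: "P \<subseteq> sets ?M"
  proof -
    have "{x\<in>S. x 0 = a} \<in> sets ?M" for a
    proof -
      have borel: "{x :: int \<Rightarrow> nat. x 0 = a} \<in> sets borel"
        by (rule borel_open[OF open_coordinate[of "\<lambda>b. b = a" 0]])
      have "{x\<in>S. x 0 = a} \<in> sets (restrict_space borel S)"
        unfolding sets_restrict_space by (rule image_eqI[OF _ borel]) blast
      then show ?thesis by (simp only: sets_restrict_bernoulli)
    qed
    then show ?thesis unfolding P_def by (rule image_subsetI)
  qed
  have cell: "measure ?M (name_cell (space ?M) left_shift n w) \<le> (1 / real (card A)) ^ n"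
    if w: "w \<in> PiE {..<n} (\<lambda>_. P)" for n w
  proof -
    have "\<exists>a. w k = {x\<in>S. x 0 = a}" if "k < n" for k
    proof -
      have "w k \<in> P" using PiE_mem[OF w, of k] that by simp
      then show ?thesis unfolding P_def by (rule imageE) (rule exI)
    qed
    then obtain a where a: "\<And>k. k < n \<Longrightarrow> w k = {x\<in>S. x 0 = a k}" by metis
    have "measure ?M (name_cell (space ?M) left_shift n w) =
        measure (bernoulli A) (name_cell (space ?M) left_shift n w)"
      using SQ by (intro measure_restrict_space) (auto simp: space_bernoulli name_cell_def space_restrict_space)
    also have "\<dots> \<le> measure (bernoulli A) {x. \<forall>k<n. x (int k) = a k}"
    proof (rule finite_measure.finite_measure_mono)
      show "finite_measure (bernoulli A)"
        using prob_space_bernoulli by (simp add: prob_space.finite_measure)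
      show "name_cell (space ?M) left_shift n w \<subseteq> {x. \<forall>k<n. x (int k) = a k}"
        using a by (auto simp: name_cell_def left_shift_funpow)
      have "open {x. \<forall>i\<in>int ` {..<n}. x i = a (nat i)}"
        by (rule open_finite_window) simp
      moreover have "{x. \<forall>i\<in>int ` {..<n}. x i = a (nat i)} = {x. \<forall>k<n. x (int k) = a k}"
        by auto
      ultimately have "open {x. \<forall>k<n. x (int k) = a k}" by simp
      then show "{x. \<forall>k<n. x (int k) = a k} \<in> sets (bernoulli A)"
        by (simp add: sets_bernoulli borel_open)
    qed
    also have "\<dots> \<le> (1 / real (card A)) ^ n" by (rule bernoulli_cylinder_le[OF A])
    finally show ?thesis .
  qed
  have lower: "real n * ln (real (card A)) \<le>
      partition_entropy ?M (iterated_join (space ?M) left_shift P n)" for n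
  proof -
    let ?W = "PiE {..<n} (\<lambda>_. P)" and ?\<mu> = "\<lambda>w. measure ?M (name_cell (space ?M) left_shift n w)"
    have "real n * ln (real (card A)) = (\<Sum>w\<in>?W. ?\<mu> w * (real n * ln (real (card A))))"
      unfolding sum_distrib_right[symmetric] sum_measure_name_cell[OF M(1,3) fP PM partP] by simp
    also have "\<dots> \<le> (\<Sum>w\<in>?W. - (?\<mu> w * ln (?\<mu> w)))"
    proof (rule sum_mono)
      fix w assume w: "w \<in> ?W"
      show "?\<mu> w * (real n * ln (real (card A))) \<le> - (?\<mu> w * ln (?\<mu> w))"
      proof (cases "?\<mu> w = 0")
        case False
        then have pos: "?\<mu> w > 0" by (simp add: less_le)
        have "ln (?\<mu> w) \<le> ln ((1 / real (card A)) ^ n)"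
          using cell[OF w] pos cA by (intro iffD2[OF ln_le_cancel_iff]) auto
        also have "\<dots> = - (real n * ln (real (card A)))"
          using cA by (simp add: ln_realpow ln_div)
        finally have "real n * ln (real (card A)) \<le> - ln (?\<mu> w)" by simp
        then have "?\<mu> w * (real n * ln (real (card A))) \<le> ?\<mu> w * - ln (?\<mu> w)"
          using pos by (intro mult_left_mono) auto
        then show ?thesis by simp
      qed simp
    qed
    also have "\<dots> = partition_entropy ?M (iterated_join (space ?M) left_shift P n)"
      unfolding partition_entropy_join[OF fP partP] by (simp add: sum_negf)
    finally show ?thesis .
  qed
  have "ereal (ln (real (card A))) = limsup (\<lambda>n. ereal (ln (real (card A))))"
    by (simp add: Limsup_const)
  also have "\<dots> \<le> metric_entropy_partition ?M left_shift P"
    unfolding metric_entropy_partition_def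
  proof (intro Limsup_mono eventually_sequentiallyI[of 1])
    fix n :: nat assume "1 \<le> n"
    then show "ereal (ln (real (card A))) \<le>
        ereal (partition_entropy ?M (iterated_join (space ?M) left_shift P n) / real n)"
      using lower[of n] by (simp add: field_simps)
  qed
  also have "\<dots> \<le> metric_entropy ?M left_shift"
    unfolding metric_entropy_def using fP PM partP by (intro SUP_upper) auto
  finally show "ereal (ln (real (card A))) \<le> metric_entropy ?M left_shift" .
qed

section \<open>Topological entropy\<close>

lemma open_contains_agree:
  assumes "open (U :: (int \<Rightarrow> nat) set)" "x \<in> U"
  shows "\<exists>m. \<forall>y. agree m x y \<longrightarrow> y \<in> U"
proof -
  have "openin (product_topology (\<lambda>i::int. euclidean :: nat topology) UNIV) U"
    using assms(1) by (simp add: open_fun_def)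
  from product_topology_open_contains_basis[OF this assms(2)]
  obtain V where V: "x \<in> PiE UNIV V" "finite {i. V i \<noteq> UNIV}" "PiE UNIV V \<subseteq> U" by auto
  define m where "m = Max (insert 0 ((\<lambda>i. nat \<bar>i\<bar>) ` {i. V i \<noteq> UNIV}))"
  have "y \<in> U" if "agree m x y" for y
  proof -
    have "y i \<in> V i" for i
    proof (cases "V i = UNIV")
      case False
      then have "nat \<bar>i\<bar> \<le> m" unfolding m_def using V(2) by (intro Max_ge) auto
      then have "i \<in> {- int m..int m}" by auto
      then have "x i = y i" using that unfolding agree_def by blast
      then show ?thesis using V(1) by (metis PiE_mem UNIV_I)
    qed simp
    then show ?thesis using V(3) by auto
  qed
  then show ?thesis by blast
qed

text \<open>Lebesgue's number lemma in symbolic form: by compactness, one window size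
  \<open>m\<close> serves all points.\<close>

lemma open_cover_window:
  fixes S :: "(int \<Rightarrow> nat) set"
  assumes S: "compact S" and U: "open_cover (top_of_set S) \<U>"
  shows "\<exists>m. \<forall>x\<in>S. \<exists>V\<in>\<U>. \<forall>y\<in>S. agree m x y \<longrightarrow> y \<in> V"
proof -
  have "\<exists>V m. V \<in> \<U> \<and> (\<forall>y\<in>S. agree m x y \<longrightarrow> y \<in> V)" if x: "x \<in> S" for x
  proof -
    obtain V where V: "V \<in> \<U>" "x \<in> V" using U x by (auto simp: open_cover_def)
    then obtain T where T: "open T" "V = S \<inter> T"
      using U by (auto simp: open_cover_def openin_open)
    then obtain m where "\<forall>y. agree m x y \<longrightarrow> y \<in> T" using open_contains_agree[of T x] V by blast
    then show ?thesis using V T by blast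
  qed
  then obtain V m where Vm: "\<And>x. x \<in> S \<Longrightarrow> V x \<in> \<U>"
    "\<And>x y. x \<in> S \<Longrightarrow> y \<in> S \<Longrightarrow> agree (m x) x y \<Longrightarrow> y \<in> V x" by metis
  have "S \<subseteq> (\<Union>x\<in>S. {y. agree (m x) x y})" by (auto simp: agree_def)
  then obtain D where D: "D \<subseteq> S" "finite D" "S \<subseteq> (\<Union>x\<in>D. {y. agree (m x) x y})"
    using compactE_image[OF S, of S "\<lambda>x. {y. agree (m x) x y}"] open_agree by blast
  define M where "M = Max (insert 0 (m ` D))"
  have "\<exists>V\<in>\<U>. \<forall>y\<in>S. agree M x y \<longrightarrow> y \<in> V" if x: "x \<in> S" for x
  proof -
    obtain z where z: "z \<in> D" "agree (m z) z x" using D(3) x by blast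
    have "m z \<le> M" unfolding M_def using D z by (intro Max_ge) auto
    have "y \<in> V z" if "y \<in> S" "agree M x y" for y
    proof -
      have "agree (m z) x y" using agree_mono[OF that(2) \<open>m z \<le> M\<close>] .
      then have "agree (m z) z y" using z(2) by (simp add: agree_def)
      then show ?thesis using Vm(2)[of z y] z D that by blast
    qed
    then show ?thesis using Vm(1)[of z] z D by blast
  qed
  then show ?thesis by blast
qed

lemma Union_iterated_join:
  assumes "\<Union>\<U> = S" "T ` S \<subseteq> S"
  shows "\<Union>(iterated_join S T \<U> n) = S"
proof
  show "S \<subseteq> \<Union>(iterated_join S T \<U> n)"
  proof
    fix x assume x: "x \<in> S"
    have "(T ^^ k) x \<in> S" for k using assms(2) x by (induction k) auto
    then have "\<forall>k. \<exists>u\<in>\<U>. (T ^^ k) x \<in> u" using assms(1) by blast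
    then obtain u where "\<And>k. u k \<in> \<U>" "\<And>k. (T ^^ k) x \<in> u k" by metis
    then show "x \<in> \<Union>(iterated_join S T \<U> n)"
      using x unfolding iterated_join_def by blast
  qed
qed (auto simp: iterated_join_def)

text \<open>The word read from position \<open>-m\<close> on determines the
  \<open>m\<close>-neighbourhood of each of the first \<open>n\<close> iterates. So all points with
  the same word fit into one element of the join, and there is a subcover with no more elements than
  there are words.\<close>

lemma subcover_number_join_le:
  fixes S :: "(int \<Rightarrow> nat) set"
  assumes shift: "\<And>x s. x \<in> S \<Longrightarrow> (\<lambda>i. x (i + s)) \<in> S"
    and window: "\<forall>x\<in>S. \<exists>V\<in>\<U>. \<forall>y\<in>S. agree m x y \<longrightarrow> y \<in> V"
    and U: "\<Union>\<U> = S" and fin: "finite ((\<lambda>x. word x (n + 2 * m + 1)) ` S)"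
  shows "subcover_number (iterated_join S left_shift \<U> n) \<le> card ((\<lambda>x. word x (n + 2 * m + 1)) ` S)"
proof -
  let ?N = "n + 2 * m + 1"
  have TS: "left_shift ` S \<subseteq> S" using shift[of _ 1] by (auto simp: left_shift_def)
  have TkS: "(left_shift ^^ k) x \<in> S" if "x \<in> S" for k x
    using shift[OF that, of "int k"] by (simp add: left_shift_funpow)
  define v where "v x = word (\<lambda>i. x (i + (- int m))) ?N" for x
  have vS: "v ` S \<subseteq> (\<lambda>x. word x ?N) ` S" using shift[of _ "- int m"] unfolding v_def by blast
  then have fv: "finite (v ` S)" using fin finite_subset by blast
  have agree_v: "agree m ((left_shift ^^ k) x) ((left_shift ^^ k) y)" if "v x = v y" "k < n" for x y k
    unfolding agree_def left_shift_funpow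
  proof
    fix i assume i: "i \<in> {- int m..int m}"
    define j where "j = nat (i + int k + int m)"
    \<comment> \<open>\<open>j\<close> is the index of position \<open>i + k\<close> in the word,
      which starts at \<open>-m\<close>.\<close>
    have j: "j < ?N" "int j = i + int k + int m" using i \<open>k < n\<close> by (auto simp: j_def)
    have "v x ! j = v y ! j" using that by simp
    then show "x (i + int k) = y (i + int k)" using j by (simp add: v_def)
  qed
  obtain u where u: "\<And>x. x \<in> S \<Longrightarrow> u x \<in> \<U>" "\<And>x y. x \<in> S \<Longrightarrow> y \<in> S \<Longrightarrow> agree m x y \<Longrightarrow> y \<in> u x"
    using window by metis
  define r where "r = inv_into S v"
  \<comment> \<open>For every word, the join element assembled along the orbit of one representative
    \<open>r c\<close>.\<close>
  define \<V> where "\<V> = (\<lambda>c. {y \<in> S. \<forall>k<n. (left_shift ^^ k) y \<in> u ((left_shift ^^ k) (r c))}) ` v ` S"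
  have rS: "r c \<in> S" "v (r c) = c" if "c \<in> v ` S" for c
    using that by (auto simp: r_def inv_into_into f_inv_into_f)
  have sub: "\<V> \<subseteq> iterated_join S left_shift \<U> n"
    unfolding \<V>_def
  proof (rule image_subsetI)
    fix c assume "c \<in> v ` S"
    then have "\<forall>k<n. u ((left_shift ^^ k) (r c)) \<in> \<U>" using u(1) TkS rS(1) by blast
    then show "{y \<in> S. \<forall>k<n. (left_shift ^^ k) y \<in> u ((left_shift ^^ k) (r c))} \<in> iterated_join S left_shift \<U> n"
      unfolding iterated_join_def
      by (intro CollectI exI[of _ "\<lambda>k. u ((left_shift ^^ k) (r c))"]) simp
  qed
  have "S \<subseteq> \<Union>\<V>"
  proof
    fix y assume y: "y \<in> S"
    have "y \<in> {y' \<in> S. \<forall>k<n. (left_shift ^^ k) y' \<in> u ((left_shift ^^ k) (r (v y)))}"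
      using y u(2) TkS rS[of "v y"] agree_v[of "r (v y)" y] by auto
    then show "y \<in> \<Union>\<V>" using y unfolding \<V>_def by blast
  qed
  moreover have "\<Union>\<V> \<subseteq> S" by (auto simp: \<V>_def)
  ultimately have cover: "\<Union>\<V> = \<Union>(iterated_join S left_shift \<U> n)"
    using Union_iterated_join[OF U TS] by auto
  have fV: "finite \<V>" unfolding \<V>_def using fv by blast
  have "subcover_number (iterated_join S left_shift \<U> n) \<le> card \<V>"
    unfolding subcover_number_def using sub fV cover by (intro Least_le) blast
  also have "\<dots> \<le> card (v ` S)" unfolding \<V>_def using fv by (rule card_image_le)
  also have "\<dots> \<le> card ((\<lambda>x. word x ?N) ` S)" using fin vS by (rule card_mono)
  finally show ?thesis .
qed

text \<open>For a given cover the words are longer than \<open>n\<close> by the constant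
  \<open>2 * m + 1\<close>. This excess and the polynomial factor disappear after taking logarithms
  and dividing by \<open>n\<close>.\<close>

lemma topological_entropy_le:
  fixes S :: "(int \<Rightarrow> nat) set" and \<beta> :: real
  assumes S: "compact S" and shift: "\<And>x s. x \<in> S \<Longrightarrow> (\<lambda>i. x (i + s)) \<in> S"
    and fin: "\<And>n. finite ((\<lambda>x. word x n) ` S)"
    and growth: "\<And>n. real (card ((\<lambda>x. word x n) ` S)) \<le> (3 * real n ^ 2 + 1) * \<beta> ^ n"
    and \<beta>: "\<beta> \<ge> 1"
  shows "topological_entropy (top_of_set S) left_shift \<le> ereal (ln \<beta>)"
  unfolding topological_entropy_def
proof (rule SUP_least, clarify)
  fix \<U> assume U: "open_cover (top_of_set S) \<U>"
  obtain m where m: "\<forall>x\<in>S. \<exists>V\<in>\<U>. \<forall>y\<in>S. agree m x y \<longrightarrow> y \<in> V"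
    using open_cover_window[OF S U] by blast
  have US: "\<Union>\<U> = S" using U by (simp add: open_cover_def)
  let ?c = "\<lambda>n. subcover_number (iterated_join (topspace (top_of_set S)) left_shift \<U> n)"
  \<comment> \<open>The part of \<open>ln (4 * N^2 * \<beta>^N)\<close> that does not grow with
    \<open>n\<close>, obtained from \<open>N = n + 2 * m + 1 \<le> (2 * m + 2) * n\<close>.\<close>
  define K where "K = ln 4 + 2 * ln (2 * real m + 2) + (2 * real m + 1) * ln \<beta>"
  have ln\<beta>: "ln \<beta> \<ge> 0" using \<beta> by simp
  have bound: "ln (real (?c n)) / real n \<le> ln \<beta> + K / real n + 2 * (ln (real n) / real n)"
    if n: "n \<ge> 1" for n
  proof -
    define N where "N = n + 2 * m + 1"
    have N1: "N \<ge> 1" by (simp add: N_def)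
    have "real (?c n) \<le> real (card ((\<lambda>x. word x N) ` S))"
      using subcover_number_join_le[OF shift m US fin, of n] by (simp add: N_def)
    also have "\<dots> \<le> (3 * real N ^ 2 + 1) * \<beta> ^ N" by (rule growth)
    also have "\<dots> \<le> (4 * real N ^ 2) * \<beta> ^ N"
      using \<beta> N1 by (intro mult_right_mono) auto
    finally have c: "real (?c n) \<le> (4 * real N ^ 2) * \<beta> ^ N" .
    \<comment> \<open>Also covers \<open>?c n = 0\<close>: there the left side is
      \<open>ln 0 = 0\<close>, and the right side has to be nonnegative.\<close>
    have one: "1 \<le> (4 * real N ^ 2) * \<beta> ^ N"
    proof -
      have "1 \<le> 4 * real N ^ 2" "1 \<le> \<beta> ^ N" using N1 \<beta> by (auto simp: one_le_power intro: order_trans[of 1 "real N ^ 2"])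
      then have "1 * 1 \<le> (4 * real N ^ 2) * \<beta> ^ N" by (intro mult_mono) auto
      then show ?thesis by simp
    qed
    have "ln (real (?c n)) \<le> ln ((4 * real N ^ 2) * \<beta> ^ N)"
    proof (cases "?c n = 0")
      case True
      then show ?thesis using one by simp
    next
      case False
      then show ?thesis using c by (intro iffD2[OF ln_le_cancel_iff] less_le_trans[OF _ one]) auto
    qed
    also have "\<dots> = ln 4 + 2 * ln (real N) + real N * ln \<beta>"
      using N1 \<beta> by (simp add: ln_mult ln_realpow)
    also have "ln (real N) \<le> ln ((2 * real m + 2) * real n)"
    proof (intro iffD2[OF ln_le_cancel_iff])
      have "real m * 1 \<le> real m * real n" using n by (intro mult_left_mono) auto
      then show "real N \<le> (2 * real m + 2) * real n" using n by (simp add: N_def algebra_simps)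
    qed (use n N1 in auto)
    also have "\<dots> = ln (2 * real m + 2) + ln (real n)" using n by (simp add: ln_mult)
    finally have "ln (real (?c n)) \<le> K + 2 * ln (real n) + real n * ln \<beta>"
      by (simp add: K_def N_def algebra_simps)
    then have "ln (real (?c n)) / real n \<le> (K + 2 * ln (real n) + real n * ln \<beta>) / real n"
      by (intro divide_right_mono) auto
    also have "\<dots> = ln \<beta> + K / real n + 2 * (ln (real n) / real n)"
      using n by (simp add: add_divide_distrib)
    finally show ?thesis .
  qed
  have "cover_entropy (top_of_set S) left_shift \<U> \<le>
      limsup (\<lambda>n. ereal (ln \<beta> + K / real n + 2 * (ln (real n) / real n)))"
    unfolding cover_entropy_def
    using bound by (intro Limsup_mono eventually_sequentiallyI[of 1]) (simp add: ereal_less_eq)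
  also have "\<dots> = ereal (ln \<beta> + 0 + 2 * 0)"
  proof (rule lim_imp_Limsup)
    show "(\<lambda>n. ereal (ln \<beta> + K / real n + 2 * (ln (real n) / real n))) \<longlonglongrightarrow> ereal (ln \<beta> + 0 + 2 * 0)"
      by (intro tendsto_ereal tendsto_add tendsto_const tendsto_mult lim_const_over_n lim_ln_over_n)
  qed simp
  finally show "cover_entropy (top_of_set S) left_shift \<U> \<le> ereal (ln \<beta>)" by simp
qed

text \<open>In the cover by the symbol at 0, an element of the join fixes the first \<open>n\<close>
  symbols. The words over \<open>A\<close> extend to points of \<open>S\<close>, which must all lie
  in different elements of any subcover.\<close>

lemma topological_entropy_ge:
  fixes S :: "(int \<Rightarrow> nat) set"
  assumes A: "finite A" "A \<noteq> {}" "full_shift A \<subseteq> S" and F: "finite F" "S \<subseteq> full_shift F"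
    and TS: "left_shift ` S \<subseteq> S"
  shows "ereal (ln (real (card A))) \<le> topological_entropy (top_of_set S) left_shift"
proof -
  have cA: "card A > 0" using A by (simp add: card_gt_0_iff)
  obtain a0 where a0: "a0 \<in> A" using A by blast
  define \<U> where "\<U> = (\<lambda>a. {x\<in>S. x 0 = a}) ` F"
  have fU: "finite \<U>" using F by (simp add: \<U>_def)
  have US: "\<Union>\<U> = S" using F by (auto simp: \<U>_def full_shift_def)
  have "openin (top_of_set S) {x\<in>S. x 0 = a}" for a
    using open_coordinate[of "\<lambda>b. b = a" 0] unfolding openin_open
    by (intro exI[of _ "{x. x 0 = a}"]) auto
  then have cover: "open_cover (top_of_set S) \<U>"
    using US by (auto simp: open_cover_def \<U>_def)
  have number: "card A ^ n \<le> subcover_number (iterated_join S left_shift \<U> n)" (is "_ \<le> subcover_number ?J") for n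
  proof -
    have "iterated_join S left_shift \<U> n = name_cell S left_shift n ` PiE {..<n} (\<lambda>_. \<U>)"
      by (rule iterated_join_eq)
    then have "finite ?J" using fU by (auto intro!: finite_PiE)
    \<comment> \<open>The finite join is a finite subcover of itself, so the least size is attained
      by an actual subcover.\<close>
    then have "\<exists>m. \<exists>\<V>\<subseteq>?J. finite \<V> \<and> card \<V> = m \<and> \<Union>\<V> = \<Union>?J" by blast
    from LeastI_ex[OF this, folded subcover_number_def] obtain \<V> where V: "\<V> \<subseteq> ?J" "finite \<V>"
      "card \<V> = subcover_number ?J" "\<Union>\<V> = \<Union>?J"
      by (elim exE conjE) (rule that)
    let ?W = "PiE {..<n} (\<lambda>_. A)"
    \<comment> \<open>Padding with \<open>a0\<close> keeps the point in the full shift over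
      \<open>A\<close>, hence in \<open>S\<close>.\<close>
    define pt where "pt w i = (if 0 \<le> i \<and> i < int n then w (nat i) else a0)" for w :: "nat \<Rightarrow> nat" and i :: int
    have ptS: "pt w \<in> S" if "w \<in> ?W" for w
    proof -
      have "pt w i \<in> A" for i
        using PiE_mem[OF that, of "nat i"] a0 by (simp add: pt_def nat_less_iff)
      then show ?thesis using A(3) by (auto simp: full_shift_def)
    qed
    have "\<forall>w\<in>?W. \<exists>c\<in>\<V>. pt w \<in> c"
      using ptS Union_iterated_join[OF US TS, of n] V(4) by blast
    then obtain c where c: "\<And>w. w \<in> ?W \<Longrightarrow> c w \<in> \<V>" "\<And>w. w \<in> ?W \<Longrightarrow> pt w \<in> c w" by metis
    have "inj_on c ?W"
    proof (rule inj_onI)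
      fix w w' assume w: "w \<in> ?W" "w' \<in> ?W" "c w = c w'"
      then have "c w \<in> ?J" using c V by blast
      then obtain u where u: "c w = {x \<in> S. \<forall>k<n. (left_shift ^^ k) x \<in> u k}" "\<forall>k<n. u k \<in> \<U>"
        unfolding iterated_join_def by blast
      show "w = w'"
      proof (rule PiE_ext[OF w(1,2)])
        fix k assume k: "k \<in> {..<n}"
        then obtain a where a: "u k = {x\<in>S. x 0 = a}" using u(2) by (auto simp: \<U>_def)
        have "(left_shift ^^ k) (pt w) \<in> u k" "(left_shift ^^ k) (pt w') \<in> u k"
          using c(2)[OF w(1)] c(2)[OF w(2)] k w(3) u(1) by auto
        then have "pt w (int k) = pt w' (int k)" using a by (simp add: left_shift_funpow)
        then show "w k = w' k" using k by (simp add: pt_def)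
      qed
    qed
    moreover have "c ` ?W \<subseteq> \<V>" using c(1) by blast
    ultimately have "card ?W \<le> card \<V>" using card_inj_on_le V(2) by blast
    then show ?thesis using V(3) by (simp add: card_PiE)
  qed
  have "ereal (ln (real (card A))) = limsup (\<lambda>n. ereal (ln (real (card A))))"
    by (simp add: Limsup_const)
  also have "\<dots> \<le> cover_entropy (top_of_set S) left_shift \<U>"
    unfolding cover_entropy_def
  proof (intro Limsup_mono eventually_sequentiallyI[of 1])
    fix n :: nat assume n: "1 \<le> n"
    let ?s = "subcover_number (iterated_join (topspace (top_of_set S)) left_shift \<U> n)"
    have "real (card A ^ n) \<le> real ?s" using number[of n] by (intro of_nat_mono) simp
    then have "ln (real (card A) ^ n) \<le> ln (real ?s)"
    proof (intro iffD2[OF ln_le_cancel_iff])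
      show p: "0 < real (card A) ^ n" using cA by simp
      show le: "real (card A) ^ n \<le> real ?s" using \<open>real (card A ^ n) \<le> real ?s\<close> by simp
      show "0 < real ?s" by (rule less_le_trans[OF p le])
    qed
    then have "real n * ln (real (card A)) \<le> ln (real ?s)" using cA by (simp add: ln_realpow)
    then show "ereal (ln (real (card A))) \<le> ereal (ln (real ?s) / real n)"
      using n by (simp add: field_simps)
  qed
  also have "\<dots> \<le> topological_entropy (top_of_set S) left_shift"
    unfolding topological_entropy_def using cover by (intro SUP_upper) simp
  finally show ?thesis .
qed

section \<open>Measures of maximal entropy\<close>

lemma full_shift_subset_two_coloured_shift:
  "full_shift (green \<nu>) \<subseteq> two_coloured_shift \<nu> \<tau>" "full_shift (yellow \<nu>) \<subseteq> two_coloured_shift \<nu> \<tau>"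
  by (auto simp: two_coloured_shift_def full_shift_def alphabet_def)

lemma topological_entropy_two_coloured_shift:
  assumes \<nu>: "\<nu> \<ge> 2" and \<tau>: "\<tau> > 0" "\<tau> \<ge> ln 3 / ln (real \<nu>)"
  shows "topological_entropy (top_of_set (two_coloured_shift \<nu> \<tau>)) left_shift = ereal (ln (real \<nu>))"
proof (rule antisym)
  let ?S = "two_coloured_shift \<nu> \<tau>"
  note shift = two_coloured_shift_translate[OF \<tau>(1)]
  show "topological_entropy (top_of_set ?S) left_shift \<le> ereal (ln (real \<nu>))"
    by (rule topological_entropy_le[OF compact_two_coloured_shift[OF \<tau>(1)] shift finite_words
          card_words[OF \<nu> \<tau>]]) (use \<nu> in auto)
  have "ereal (ln (real (card (green \<nu>)))) \<le> topological_entropy (top_of_set ?S) left_shift"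
  proof (rule topological_entropy_ge)
    show "?S \<subseteq> full_shift (alphabet \<nu>)" by (auto simp: two_coloured_shift_def)
    show "left_shift ` ?S \<subseteq> ?S" using shift[of _ \<nu> 1] by (auto simp: left_shift_def)
    show "full_shift (green \<nu>) \<subseteq> ?S" by (rule full_shift_subset_two_coloured_shift)
  qed (use \<nu> in \<open>auto simp: green_def alphabet_def yellow_def\<close>)
  then show "ereal (ln (real \<nu>)) \<le> topological_entropy (top_of_set ?S) left_shift"
    by (simp add: green_def)
qed

lemma measure_of_maximal_entropy_bernoulli:
  assumes \<nu>: "\<nu> \<ge> 2" and \<tau>: "\<tau> > 0" "\<tau> \<ge> ln 3 / ln (real \<nu>)"
    and A: "full_shift A \<subseteq> two_coloured_shift \<nu> \<tau>" "finite A" "card A = \<nu>"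
  shows "measure_of_maximal_entropy (two_coloured_shift \<nu> \<tau>)
           (restrict_space (bernoulli A) (two_coloured_shift \<nu> \<tau>))"
proof -
  let ?S = "two_coloured_shift \<nu> \<tau>"
  have ne: "A \<noteq> {}" using A \<nu> by auto
  have S: "?S \<in> sets borel" using closed_two_coloured_shift[OF \<tau>(1)] by (rule borel_closed)
  have TS: "left_shift ` ?S \<subseteq> ?S"
    using two_coloured_shift_translate[OF \<tau>(1), of _ \<nu> 1] by (auto simp: left_shift_def)
  have F: "finite (alphabet \<nu>)" "?S \<subseteq> full_shift (alphabet \<nu>)"
    by (auto simp: alphabet_def green_def yellow_def two_coloured_shift_def)
  show ?thesis
    unfolding measure_of_maximal_entropy_def topological_entropy_two_coloured_shift[OF \<nu> \<tau>]
      metric_entropy_restrict_bernoulli[OF A(2) ne S A(1) TS F] A(3)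
    using sets_restrict_bernoulli prob_space_restrict_bernoulli[OF A(2) ne S A(1) TS]
      invariant_restrict_bernoulli[OF A(2) ne S A(1) TS] by simp
qed

theorem mainTheorem3:
  fixes \<nu> :: nat and \<tau> :: real
  assumes "\<nu> \<ge> 2" and "\<tau> > 0" and "\<tau> \<ge> ln 3 / ln (real \<nu>)"
  shows "\<exists>\<mu>\<^sub>1 \<mu>\<^sub>2. measure_of_maximal_entropy (two_coloured_shift \<nu> \<tau>) \<mu>\<^sub>1 \<and>
                measure_of_maximal_entropy (two_coloured_shift \<nu> \<tau>) \<mu>\<^sub>2 \<and>
                mutually_singular \<mu>\<^sub>1 \<mu>\<^sub>2"
proof -
  let ?S = "two_coloured_shift \<nu> \<tau>"
  let ?\<mu> = "\<lambda>A. restrict_space (bernoulli A) ?S"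
  have G: "finite (green \<nu>)" "green \<nu> \<noteq> {}" "card (green \<nu>) = \<nu>"
    and Y: "finite (yellow \<nu>)" "yellow \<nu> \<noteq> {}" "card (yellow \<nu>) = \<nu>"
    using assms(1) by (auto simp: green_def yellow_def)
  have S: "?S \<in> sets borel" using closed_two_coloured_shift[OF assms(2)] by (rule borel_closed)
  have TS: "left_shift ` ?S \<subseteq> ?S"
    using two_coloured_shift_translate[OF assms(2), of _ \<nu> 1] by (auto simp: left_shift_def)
  \<comment> \<open>The colour of the single symbol at 0 already separates the measures: almost
    surely it is green for one and yellow for the other.\<close>
  define E where "E = ?S \<inter> {x. x 0 \<in> yellow \<nu>}"
  have E: "E \<in> sets (restrict_space borel ?S)"
    unfolding E_def sets_restrict_space
    by (rule imageI) (rule borel_open[OF open_coordinate])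
  then have EA: "E \<in> sets (?\<mu> A)" for A by (simp only: sets_restrict_bernoulli)
  have "AE x in ?\<mu> (green \<nu>). x \<notin> E"
    using AE_restrict_bernoulli[OF G(1,2) S full_shift_subset_two_coloured_shift(1) TS]
    by eventually_elim (use colour_disjoint in \<open>auto simp: E_def\<close>)
  then have "emeasure (?\<mu> (green \<nu>)) E = 0"
    using EA[of "green \<nu>"] by (subst (asm) AE_iff_measurable[OF _ refl]) (auto simp: E_def space_restrict_space space_bernoulli Int_def)
  moreover have "AE x in ?\<mu> (yellow \<nu>). x \<in> E"
    using AE_restrict_bernoulli[OF Y(1,2) S full_shift_subset_two_coloured_shift(2) TS] AE_space
    by eventually_elim (auto simp: E_def space_restrict_space)
  then have "emeasure (?\<mu> (yellow \<nu>)) (space (?\<mu> (yellow \<nu>)) - E) = 0"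
    using EA[of "yellow \<nu>"] by (subst (asm) AE_iff_measurable[OF _ refl]) (auto simp: set_diff_eq)
  ultimately have "mutually_singular (?\<mu> (green \<nu>)) (?\<mu> (yellow \<nu>))"
    unfolding mutually_singular_def using EA by blast
  then show ?thesis
    using measure_of_maximal_entropy_bernoulli[OF assms full_shift_subset_two_coloured_shift(1) G(1,3)]
      measure_of_maximal_entropy_bernoulli[OF assms full_shift_subset_two_coloured_shift(2) Y(1,3)]
    by blast
qed

end
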